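(* For every natural number $p\ge 3$, the group $BS(1,p)$ is in the class $TC_\rho$ with $\rho$ linear. Moreover, the Cayley complex for the presentation $BS(1,p)=\langle a,t\mid tat^{-1}=a^{p}\rangle$ has a 1-combing admitting the radial tameness function $\rho(q)=4(h+2)q+[4(h+2)+1](h+4)$, where $h=\lfloor p/2\rfloor$.
   Context: Let $G=\langle A\mid R\rangle$ be a finitely presented group with $A$ inverse-closed and $R=\{r_1,\dots,r_k\}$, $r_i$ of length $n_i$; let $X$ be its Cayley 2-complex, with $X^0=G$, $X^1$ the Cayley graph, $\epsilon$ the identity vertex. Levels: for $g\in X^0$, $\mathrm{lev}(g)$ is the word length of $g$ over $A$; for $x$ in the interior of an edge with endpoints $g,h$, $\mathrm{lev}(x)=\frac{\mathrm{lev}(g)+\mathrm{lev}(h)}{2}+\frac14$; for $x$ in the interior of a 2-cell with boundary vertices $g_1,\dots,g_n$, $\mathrm{lev}(x)=\frac{\mathrm{lev}(g_1)+\cdots+\mathrm{lev}(g_n)}{n}+\frac14+\frac1c$ where $c=4n_1\cdots n_k+1$. A 1-combing is a continuous $\Psi:X^1\times[0,1]\to X$ with $\Psi(x,0)=\epsilon$, $\Psi(x,1)=x$ for all $x\in X^1$, and $\Psi(X^0\times[0,1])\subseteq X^1$. A function $\rho:\mathbb{Q}\to\mathbb{R}_+$ is a radial tameness function for $\Psi$ if for all $x\in X^1$, $0\le s<t\le1$, $q\in\mathbb{Q}$, $\mathrm{lev}(\Psi(x,s))>\rho(q)$ implies $\mathrm{lev}(\Psi(x,t))>q$. A group with a finite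 presentation is in $TC_\rho$ if the Cayley complex of the presentation admits a 1-combing with radial tameness function $\rho$. Here the generating set is $A=\{a^{\pm1},t^{\pm1}\}$. *)

theory Defs
  imports "HOL-Analysis.Analysis"
begin

text \<open>Alphabet: type 'a (the finite inverse-closed generating set A), with formal
inverse function ginv. Relators: list R of words.\<close>

definition word_step :: "('a \<Rightarrow> 'a) \<Rightarrow> 'a list list \<Rightarrow> ('a list \<times> 'a list) set" where
  "word_step ginv R =
     {(u @ v, u @ [x, ginv x] @ v) | u v x. True} \<union> {(u @ v, u @ r @ v) | u v r. r \<in> set R}"

definition word_eq :: "('a \<Rightarrow> 'a) \<Rightarrow> 'a list list \<Rightarrow> ('a list \<times> 'a list) set" where
  "word_eq ginv R = (word_step ginv R \<union> (word_step ginv R)\<inverse>)\<^sup>*"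

definition grp_cls :: "('a \<Rightarrow> 'a) \<Rightarrow> 'a list list \<Rightarrow> 'a list \<Rightarrow> 'a list set" where
  "grp_cls ginv R w = word_eq ginv R `` {w}"

definition grp_elems :: "('a \<Rightarrow> 'a) \<Rightarrow> 'a list list \<Rightarrow> 'a list set set" where
  "grp_elems ginv R = range (grp_cls ginv R)"

definition grp_id :: "('a \<Rightarrow> 'a) \<Rightarrow> 'a list list \<Rightarrow> 'a list set" where
  "grp_id ginv R = grp_cls ginv R []"

definition grp_mult :: "('a \<Rightarrow> 'a) \<Rightarrow> 'a list list \<Rightarrow> 'a list set \<Rightarrow> 'a list \<Rightarrow> 'a list set" where
  "grp_mult ginv R g w = {v. \<exists>u\<in>g. (u @ w, v) \<in> word_eq ginv R}"

definition word_length :: "'a list set \<Rightarrow> nat" where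
  "word_length g = (LEAST n. \<exists>w\<in>g. length w = n)"

text \<open>Raw points: a vertex (0-cell) for each group element g; a closed edge [0,1] for each
g and generator x (from g to g x); a closed unit disk for each g and relator index i
(boundary read from g along relator i).\<close>
datatype ('g, 'a) cell_pt = RV 'g | RE 'g 'a real | RF 'g nat complex

definition raw_pts :: "('a \<Rightarrow> 'a) \<Rightarrow> 'a list list \<Rightarrow> ('a list set, 'a) cell_pt set" where
  "raw_pts ginv R =
     {RV g | g. g \<in> grp_elems ginv R}
   \<union> {RE g x s | g x s. g \<in> grp_elems ginv R \<and> 0 \<le> s \<and> s \<le> 1}
   \<union> {RF g i z | g i z. g \<in> grp_elems ginv R \<and> i < length R \<and> cmod z \<le> 1}"

text \<open>Gluing: edge endpoints to vertices; the edge (g,x) is the edge (gx, x^-1) traversed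
backwards (undirected Cayley graph); the boundary of the 2-cell (g,i), parametrised by
cis(2 pi theta), is attached along the loop at g reading relator i, the j-th arc going
linearly along the edge labelled (R!i)!j starting at g (take j (R!i)).\<close>
definition cc_glue :: "('a \<Rightarrow> 'a) \<Rightarrow> 'a list list \<Rightarrow>
    (('a list set, 'a) cell_pt \<times> ('a list set, 'a) cell_pt) set" where
  "cc_glue ginv R =
     {(RE g x 0, RV g) | g x. g \<in> grp_elems ginv R}
   \<union> {(RE g x 1, RV (grp_mult ginv R g [x])) | g x. g \<in> grp_elems ginv R}
   \<union> {(RE g x s, RE (grp_mult ginv R g [x]) (ginv x) (1 - s)) | g x s.
        g \<in> grp_elems ginv R \<and> 0 \<le> s \<and> s \<le> 1}
   \<union> {(RF g i (cis (2 * pi * (real j + u) / real (length (R ! i)))),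
        RE (grp_mult ginv R g (take j (R ! i))) (R ! i ! j) u) | g i j u.
        g \<in> grp_elems ginv R \<and> i < length R \<and> j < length (R ! i) \<and> 0 \<le> u \<and> u \<le> 1}"

definition cc_eq :: "('a \<Rightarrow> 'a) \<Rightarrow> 'a list list \<Rightarrow>
    (('a list set, 'a) cell_pt \<times> ('a list set, 'a) cell_pt) set" where
  "cc_eq ginv R = (cc_glue ginv R \<union> (cc_glue ginv R)\<inverse>)\<^sup>*"

definition cc_cls :: "('a \<Rightarrow> 'a) \<Rightarrow> 'a list list \<Rightarrow>
    ('a list set, 'a) cell_pt \<Rightarrow> ('a list set, 'a) cell_pt set" where
  "cc_cls ginv R p = cc_eq ginv R `` {p}"

definition cc_X :: "('a \<Rightarrow> 'a) \<Rightarrow> 'a list list \<Rightarrow> ('a list set, 'a) cell_pt set set" where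
  "cc_X ginv R = cc_cls ginv R ` raw_pts ginv R"

definition cc_X0 :: "('a \<Rightarrow> 'a) \<Rightarrow> 'a list list \<Rightarrow> ('a list set, 'a) cell_pt set set" where
  "cc_X0 ginv R = cc_cls ginv R ` {RV g | g. g \<in> grp_elems ginv R}"

definition cc_X1 :: "('a \<Rightarrow> 'a) \<Rightarrow> 'a list list \<Rightarrow> ('a list set, 'a) cell_pt set set" where
  "cc_X1 ginv R = cc_cls ginv R `
     ({RV g | g. g \<in> grp_elems ginv R}
      \<union> {RE g x s | g x s. g \<in> grp_elems ginv R \<and> 0 \<le> s \<and> s \<le> 1})"

definition cc_base :: "('a \<Rightarrow> 'a) \<Rightarrow> 'a list list \<Rightarrow> ('a list set, 'a) cell_pt set" where
  "cc_base ginv R = cc_cls ginv R (RV (grp_id ginv R))"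

definition cc_open :: "('a \<Rightarrow> 'a) \<Rightarrow> 'a list list \<Rightarrow> ('a list set, 'a) cell_pt set set \<Rightarrow> bool" where
  "cc_open ginv R V \<longleftrightarrow> V \<subseteq> cc_X ginv R
     \<and> (\<forall>g \<in> grp_elems ginv R. \<forall>x.
          openin (top_of_set {0..1}) {s \<in> {0..1::real}. cc_cls ginv R (RE g x s) \<in> V})
     \<and> (\<forall>g \<in> grp_elems ginv R. \<forall>i < length R.
          openin (top_of_set (cball 0 1)) {z \<in> cball (0::complex) 1. cc_cls ginv R (RF g i z) \<in> V})"

lemma istopology_cc_open: "istopology (cc_open ginv R)"
  unfolding istopology_def
proof (intro conjI allI impI)
  fix S T assume S: "cc_open ginv R S" and T: "cc_open ginv R T"
  show "cc_open ginv R (S \<inter> T)"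
    unfolding cc_open_def
  proof (intro conjI ballI allI impI)
    show "S \<inter> T \<subseteq> cc_X ginv R" using S unfolding cc_open_def by blast
  next
    fix g x assume "g \<in> grp_elems ginv R"
    then have "openin (top_of_set {0..1}) ({s \<in> {0..1::real}. cc_cls ginv R (RE g x s) \<in> S}
                 \<inter> {s \<in> {0..1::real}. cc_cls ginv R (RE g x s) \<in> T})"
      using S T unfolding cc_open_def by (intro openin_Int) auto
    then show "openin (top_of_set {0..1}) {s \<in> {0..1::real}. cc_cls ginv R (RE g x s) \<in> S \<inter> T}"
      by (simp add: Collect_conj_eq[symmetric] conj_ac)
  next
    fix g i assume "g \<in> grp_elems ginv R" "i < length R"
    then have "openin (top_of_set (cball 0 1)) ({z \<in> cball (0::complex) 1. cc_cls ginv R (RF g i z) \<in> S}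
                 \<inter> {z \<in> cball (0::complex) 1. cc_cls ginv R (RF g i z) \<in> T})"
      using S T unfolding cc_open_def by (intro openin_Int) auto
    then show "openin (top_of_set (cball 0 1)) {z \<in> cball (0::complex) 1. cc_cls ginv R (RF g i z) \<in> S \<inter> T}"
      by (simp add: Collect_conj_eq[symmetric] conj_ac)
  qed
next
  fix K assume K: "\<forall>V\<in>K. cc_open ginv R V"
  show "cc_open ginv R (\<Union>K)"
    unfolding cc_open_def
  proof (intro conjI ballI allI impI)
    show "\<Union>K \<subseteq> cc_X ginv R" using K unfolding cc_open_def by blast
  next
    fix g x assume g: "g \<in> grp_elems ginv R"
    have "openin (top_of_set {0..1}) (\<Union>V\<in>K. {s \<in> {0..1::real}. cc_cls ginv R (RE g x s) \<in> V})"
      using K g unfolding cc_open_def by (intro openin_Union) auto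
    moreover have "(\<Union>V\<in>K. {s \<in> {0..1::real}. cc_cls ginv R (RE g x s) \<in> V})
        = {s \<in> {0..1::real}. cc_cls ginv R (RE g x s) \<in> \<Union>K}" by blast
    ultimately show "openin (top_of_set {0..1}) {s \<in> {0..1::real}. cc_cls ginv R (RE g x s) \<in> \<Union>K}"
      by simp
  next
    fix g i assume g: "g \<in> grp_elems ginv R" and i: "i < length R"
    have "openin (top_of_set (cball 0 1)) (\<Union>V\<in>K. {z \<in> cball (0::complex) 1. cc_cls ginv R (RF g i z) \<in> V})"
      using K g i unfolding cc_open_def by (intro openin_Union) auto
    moreover have "(\<Union>V\<in>K. {z \<in> cball (0::complex) 1. cc_cls ginv R (RF g i z) \<in> V})
        = {z \<in> cball (0::complex) 1. cc_cls ginv R (RF g i z) \<in> \<Union>K}" by blast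
    ultimately show "openin (top_of_set (cball 0 1)) {z \<in> cball (0::complex) 1. cc_cls ginv R (RF g i z) \<in> \<Union>K}"
      by simp
  qed
qed

definition cc_top :: "('a \<Rightarrow> 'a) \<Rightarrow> 'a list list \<Rightarrow> ('a list set, 'a) cell_pt set topology" where
  "cc_top ginv R = topology (cc_open ginv R)"

definition cc_const :: "'a list list \<Rightarrow> real" where
  "cc_const R = 4 * real (\<Prod>r\<leftarrow>R. length r) + 1"

definition cc_lev :: "('a \<Rightarrow> 'a) \<Rightarrow> 'a list list \<Rightarrow> ('a list set, 'a) cell_pt set \<Rightarrow> real" where
  "cc_lev ginv R P =
    (if \<exists>g. g \<in> grp_elems ginv R \<and> RV g \<in> P
     then real (word_length (SOME g. g \<in> grp_elems ginv R \<and> RV g \<in> P))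
     else if \<exists>g x s. g \<in> grp_elems ginv R \<and> 0 < s \<and> s < 1 \<and> RE g x s \<in> P
     then (case SOME (g, x). \<exists>s. g \<in> grp_elems ginv R \<and> 0 < s \<and> s < 1 \<and> RE g x s \<in> P of
             (g, x) \<Rightarrow> (real (word_length g) + real (word_length (grp_mult ginv R g [x]))) / 2 + 1/4)
     else (case SOME (g, i). \<exists>z. g \<in> grp_elems ginv R \<and> i < length R \<and> cmod z < 1 \<and> RF g i z \<in> P of
             (g, i) \<Rightarrow> (\<Sum>j < length (R ! i). real (word_length (grp_mult ginv R g (take j (R ! i)))))
                        / real (length (R ! i)) + 1/4 + 1 / cc_const R))"

definition is_1combing :: "('a \<Rightarrow> 'a) \<Rightarrow> 'a list list \<Rightarrow>
    (('a list set, 'a) cell_pt set \<Rightarrow> real \<Rightarrow> ('a list set, 'a) cell_pt set) \<Rightarrow> bool" where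
  "is_1combing ginv R \<Psi> \<longleftrightarrow>
     continuous_map (prod_topology (subtopology (cc_top ginv R) (cc_X1 ginv R)) (top_of_set {0..1}))
                    (cc_top ginv R) (\<lambda>(P, s). \<Psi> P s)
   \<and> (\<forall>P \<in> cc_X1 ginv R. \<Psi> P 0 = cc_base ginv R \<and> \<Psi> P 1 = P)
   \<and> (\<forall>P \<in> cc_X0 ginv R. \<forall>s \<in> {0..1}. \<Psi> P s \<in> cc_X1 ginv R)"

definition radial_tameness :: "('a \<Rightarrow> 'a) \<Rightarrow> 'a list list \<Rightarrow>
    (('a list set, 'a) cell_pt set \<Rightarrow> real \<Rightarrow> ('a list set, 'a) cell_pt set) \<Rightarrow> (rat \<Rightarrow> real) \<Rightarrow> bool" where
  "radial_tameness ginv R \<Psi> \<rho> \<longleftrightarrow>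
     (\<forall>P \<in> cc_X1 ginv R. \<forall>s t q. 0 \<le> s \<and> s < t \<and> t \<le> 1 \<longrightarrow>
        cc_lev ginv R (\<Psi> P s) > \<rho> q \<longrightarrow> cc_lev ginv R (\<Psi> P t) > real_of_rat q)"

definition in_TC :: "('a \<Rightarrow> 'a) \<Rightarrow> 'a list list \<Rightarrow> (rat \<Rightarrow> real) \<Rightarrow> bool" where
  "in_TC ginv R \<rho> \<longleftrightarrow> (\<exists>\<Psi>. is_1combing ginv R \<Psi> \<and> radial_tameness ginv R \<Psi> \<rho>)"

datatype bsgen = Ga | Ga' | Gt | Gt'

fun bs_inv :: "bsgen \<Rightarrow> bsgen" where
  "bs_inv Ga = Ga'" | "bs_inv Ga' = Ga" | "bs_inv Gt = Gt'" | "bs_inv Gt' = Gt"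

definition bs_rels :: "nat \<Rightarrow> bsgen list list" where
  "bs_rels p = [[Gt, Ga, Gt'] @ replicate p Ga']"

end

theory Submission
  imports Defs
begin

text \<open>
  The complex is the product of the Bass--Serre tree with a line: over each bi-infinite ascending line
  of the tree lies a plane tiled by 2-cells. The combing path to a point of such a plane descends
  vertically from the base vertex along the line of the tree through the identity, as far as the
  geodesic of the tree to the line of the point requires, then runs horizontally at constant height,
  and finally ascends vertically. At every moment the path has used only depths and horizontal
  distances that any later point \<open>v\<close> of it is forced to have: if \<open>n\<close> is the length of \<open>v\<close>, the
  depth is at most \<open>n\<close> and the horizontal coordinate, measured in units of the lowest level reached,
  is at most \<open>p ^ (n + 2)\<close>. Writing that coordinate in base \<open>p\<close> with digits of absolute value at most
  \<open>p div 2\<close> bounds the length of every earlier vertex linearly in \<open>n\<close>.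
\<close>

section \<open>Words modulo relations\<close>

text \<open>Length is not monotone along these paths: a smaller horizontal coordinate may need
  costlier digits. The comparison therefore uses only the size and the denominator of the coordinate
  of the earlier vertex and charges the worst digits. Each unit of length of the later vertex costs
  \<open>p div 2 + 2\<close> for one more digit with its letters t and t^-1, and 2 more for descent
  and ascent. This gives the slope \<open>p div 2 + 4\<close>; the stated function dominates the
  resulting bound at every q \<ge> 0, which is enough because levels are nonnegative. A second
  obstacle is well-definedness. A point lies in many planes, and two planes agree only up to the
  height at which their lines part; the turning height of the path must not depend on the choice. A
  third is continuity: paths are given edge by edge, but the 1-skeleton has the subspace topology of
  the complex, so it must first be recognised as a quotient of the disjoint union of its
  edges.\<close>

lemma word_eq_refl: "(u, u) \<in> word_eq ginv R"
  by (simp add: word_eq_def)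

lemma word_eq_sym: "(u, v) \<in> word_eq ginv R \<Longrightarrow> (v, u) \<in> word_eq ginv R"
  unfolding word_eq_def by (meson sym_Un_converse sym_rtrancl symD)

lemma word_eq_trans:
  "(u, v) \<in> word_eq ginv R \<Longrightarrow> (v, w) \<in> word_eq ginv R \<Longrightarrow> (u, w) \<in> word_eq ginv R"
  unfolding word_eq_def by (rule rtrancl_trans)

lemma grp_cls_eq_iff: "grp_cls ginv R u = grp_cls ginv R v \<longleftrightarrow> (u, v) \<in> word_eq ginv R"
  unfolding grp_cls_def using word_eq_refl word_eq_sym word_eq_trans
  by (smt (verit, best) Image_singleton_iff subsetI subset_antisym)

lemma word_step_context:
  assumes "(u, v) \<in> word_step ginv R"
  shows "(a @ u @ b, a @ v @ b) \<in> word_step ginv R"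
  using assms unfolding word_step_def
proof (elim UnE CollectE exE conjE)
  fix u' v' x
  assume "(u, v) = (u' @ v', u' @ [x, ginv x] @ v')"
  then have "(a @ u @ b, a @ v @ b) = ((a @ u') @ (v' @ b), (a @ u') @ [x, ginv x] @ (v' @ b))"
    by simp
  then show "(a @ u @ b, a @ v @ b) \<in> {(u @ v, u @ [x, ginv x] @ v) |u v x. True} \<union>
      {(u @ v, u @ r @ v) |u v r. r \<in> set R}" by blast
next
  fix u' v' r
  assume "(u, v) = (u' @ v', u' @ r @ v')" "r \<in> set R"
  then have "(a @ u @ b, a @ v @ b) = ((a @ u') @ (v' @ b), (a @ u') @ r @ (v' @ b)) \<and> r \<in> set R"
    by simp
  then show "(a @ u @ b, a @ v @ b) \<in> {(u @ v, u @ [x, ginv x] @ v) |u v x. True} \<union>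
      {(u @ v, u @ r @ v) |u v r. r \<in> set R}" by blast
qed

lemma word_eq_context:
  assumes "(u, v) \<in> word_eq ginv R"
  shows "(a @ u @ b, a @ v @ b) \<in> word_eq ginv R"
  using assms unfolding word_eq_def
proof (induction rule: rtrancl_induct)
  case (step y z)
  then have "(a @ y @ b, a @ z @ b) \<in> word_step ginv R \<union> (word_step ginv R)\<inverse>"
    using word_step_context by fast
  with step.IH show ?case by (rule rtrancl_into_rtrancl)
qed simp

lemma grp_cls_context:
  "grp_cls ginv R u = grp_cls ginv R v \<Longrightarrow> grp_cls ginv R (a @ u @ b) = grp_cls ginv R (a @ v @ b)"
  by (simp add: grp_cls_eq_iff word_eq_context)

lemma grp_cls_append:
  assumes "grp_cls ginv R u = grp_cls ginv R u'" "grp_cls ginv R v = grp_cls ginv R v'"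
  shows "grp_cls ginv R (u @ v) = grp_cls ginv R (u' @ v')"
  using grp_cls_context[OF assms(1), of "[]" v] grp_cls_context[OF assms(2), of u' "[]"] by simp

lemma grp_cls_word_step: "(u, v) \<in> word_step ginv R \<Longrightarrow> grp_cls ginv R v = grp_cls ginv R u"
  unfolding grp_cls_eq_iff by (rule word_eq_sym) (auto simp: word_eq_def)

lemma grp_cls_cancel: "grp_cls ginv R [x, ginv x] = grp_cls ginv R []"
proof (rule grp_cls_word_step)
  have "([] @ [], [] @ [x, ginv x] @ []) \<in> word_step ginv R" unfolding word_step_def by blast
  then show "([], [x, ginv x]) \<in> word_step ginv R" by simp
qed

lemma grp_cls_relator:
  assumes "r \<in> set R"
  shows "grp_cls ginv R r = grp_cls ginv R []"
proof (rule grp_cls_word_step)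
  have "([] @ [], [] @ r @ []) \<in> word_step ginv R" unfolding word_step_def using assms by blast
  then show "([], r) \<in> word_step ginv R" by simp
qed

lemma grp_mult_cls: "grp_mult ginv R (grp_cls ginv R u) w = grp_cls ginv R (u @ w)"
proof -
  have "(u' @ w, v) \<in> word_eq ginv R \<longleftrightarrow> (u @ w, v) \<in> word_eq ginv R" if "(u, u') \<in> word_eq ginv R" for u' v
    using word_eq_context[OF that, of "[]" w] word_eq_sym word_eq_trans by (metis append_Nil)
  then show ?thesis
    unfolding grp_mult_def grp_cls_def using word_eq_refl by fastforce
qed

section \<open>Baumslag--Solitar groups as affine groups\<close>

lemma bs_inv_inv [simp]: "bs_inv (bs_inv x) = x"
  by (cases x) auto

locale baumslag_solitar =
  fixes p :: nat
  assumes p_ge_3: "3 \<le> p"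
begin

abbreviation rels :: "bsgen list list" where "rels \<equiv> bs_rels p"

definition relator :: "bsgen list" where "relator = [Gt, Ga, Gt'] @ replicate p Ga'"

lemma rels_eq: "rels = [relator]" by (simp add: bs_rels_def relator_def)

lemma length_relator: "length relator = p + 3" by (simp add: relator_def)

abbreviation cls :: "bsgen list \<Rightarrow> bsgen list set" where "cls \<equiv> grp_cls bs_inv rels"

abbreviation pw :: "int \<Rightarrow> real" where "pw k \<equiv> real p powi k"

lemma p_pos [simp]: "0 < p" "p \<noteq> 0" "Suc 0 < p" using p_ge_3 by auto

lemma pw_pos [simp]: "0 < pw k" "pw k \<noteq> 0" by (simp_all add: zero_less_power_int)

lemma pw_ge_0 [simp]: "0 \<le> pw k" by (simp add: zero_le_power_int)

lemma pw_Suc: "pw (k + 1) = real p * pw k" by (simp add: power_int_add)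

lemma pw_scaled_Ints: "pw k * real p ^ K \<in> \<int>" if "- int K \<le> k"
proof -
  have "pw k * real p ^ K = pw (k + int K)" by (simp add: power_int_add)
  also have "\<dots> = real p ^ nat (k + int K)" using that by (simp add: power_int_def)
  finally show ?thesis by simp
qed

text \<open>The pair \<open>(k, x)\<close> stands for the affine map \<open>y \<mapsto> p ^ k * y + x\<close>, so that \<open>a\<close> is
  \<open>y \<mapsto> y + 1\<close> and \<open>t\<close> is \<open>y \<mapsto> p * y\<close>; \<open>act\<close> multiplies on the right.\<close>

fun step :: "bsgen \<Rightarrow> int \<times> real \<Rightarrow> int \<times> real" where
  "step Ga (k, x) = (k, x + pw k)"
| "step Ga' (k, x) = (k, x - pw k)"
| "step Gt (k, x) = (k + 1, x)"
| "step Gt' (k, x) = (k - 1, x)"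

definition act :: "int \<times> real \<Rightarrow> bsgen list \<Rightarrow> int \<times> real" where
  "act v w = fold step w v"

lemma act_Nil [simp]: "act v [] = v" by (simp add: act_def)

lemma act_Cons [simp]: "act v (x # w) = act (step x v) w" by (simp add: act_def)

lemma act_append [simp]: "act v (u @ w) = act (act v u) w" by (simp add: act_def)

lemma step_inv [simp]: "step (bs_inv x) (step x v) = v" "step x (step (bs_inv x) v) = v"
  by (cases v; cases x; simp)+

lemma act_replicate:
  "act (k, x) (replicate n Ga) = (k, x + real n * pw k)"
  "act (k, x) (replicate n Ga') = (k, x - real n * pw k)"
  "act (k, x) (replicate n Gt) = (k + int n, x)"
  "act (k, x) (replicate n Gt') = (k - int n, x)"
  by (induction n arbitrary: k x) (auto simp: algebra_simps)

lemma act_relator: "act v relator = v"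
  by (cases v) (simp add: relator_def act_replicate pw_Suc algebra_simps)

lemma act_word_eq:
  assumes "(u, w) \<in> word_eq bs_inv rels"
  shows "act v u = act v w"
  using assms unfolding word_eq_def
proof (induction rule: rtrancl_induct)
  case (step y z)
  have "act v a = act v b" if "(a, b) \<in> word_step bs_inv rels" for a b
    using that unfolding word_step_def by (auto simp: rels_eq act_relator)
  with step show ?case by auto
qed simp

section \<open>Powers of a, and normal forms modulo the relation\<close>

definition apow :: "int \<Rightarrow> bsgen list" where
  "apow m = (if 0 \<le> m then replicate (nat m) Ga else replicate (nat (- m)) Ga')"

lemma apow_0 [simp]: "apow 0 = []" by (simp add: apow_def)

lemma act_apow: "act (k, x) (apow m) = (k, x + of_int m * pw k)"
  by (simp add: apow_def act_replicate)

lemma length_apow: "length (apow m) = nat \<bar>m\<bar>"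
  by (simp add: apow_def)

lemma cls_cancel: "cls (u @ [x, bs_inv x] @ w) = cls (u @ w)"
  using grp_cls_context[OF grp_cls_cancel[of bs_inv rels x], of u w] by simp

lemma cls_cancel': "cls (u @ [bs_inv x, x] @ w) = cls (u @ w)"
  using cls_cancel[of u "bs_inv x" w] by simp

lemma apow_int: "apow (int n) = replicate n Ga" "apow (- int n) = replicate n Ga'"
  by (auto simp: apow_def)

lemma apow_succ_nonneg: "0 \<le> m \<Longrightarrow> apow (m + 1) = apow m @ [Ga]"
  using apow_int(1)[of "Suc (nat m)"] apow_int(1)[of "nat m"]
  by (auto simp: replicate_append_same add.commute elim!: nonneg_int_cases)

lemma apow_pred_nonpos:
  assumes "m \<le> 0" shows "apow (m - 1) = apow m @ [Ga']"
proof -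
  obtain n where "m = - int n" using assms nonpos_int_cases by blast
  then have "m - 1 = - int (Suc n)" by simp
  then show ?thesis
    using apow_int(2)[of n] apow_int(2)[of "Suc n"] \<open>m = - int n\<close>
    by (simp only: replicate_append_same replicate_Suc)
qed

lemma apow_Suc: "cls (apow m @ [Ga]) = cls (apow (m + 1))"
proof (cases "0 \<le> m")
  case True
  then show ?thesis by (simp add: apow_succ_nonneg)
next
  case False
  then have "apow m = apow (m + 1) @ [Ga']"
    using apow_pred_nonpos[of "m + 1"] by simp
  then show ?thesis using cls_cancel'[of "apow (m + 1)" Ga "[]"] by simp
qed

lemma apow_pred: "cls (apow m @ [Ga']) = cls (apow (m - 1))"
proof -
  have "cls (apow (m - 1) @ [Ga] @ [Ga']) = cls (apow m @ [Ga'])"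
    using grp_cls_context[OF apow_Suc[of "m - 1"], of "[]" "[Ga']"] by simp
  then show ?thesis using cls_cancel[of "apow (m - 1)" Ga "[]"] by simp
qed

lemma apow_add: "cls (apow m @ apow n) = cls (apow (m + n))"
proof (induction n rule: int_induct[where k = 0])
  case (step1 i)
  then have "apow (i + 1) = apow i @ [Ga]" by (simp add: apow_succ_nonneg)
  then show ?case
    using grp_cls_context[OF step1(2), of "[]" "[Ga]"] apow_Suc[of "m + i"] by (simp add: add.assoc)
next
  case (step2 i)
  then have "apow (i - 1) = apow i @ [Ga']" by (simp add: apow_pred_nonpos)
  then show ?case
    using grp_cls_context[OF step2(2), of "[]" "[Ga']"] apow_pred[of "m + i"] by (simp add: add_diff_eq)
qed simp

lemma tat: "cls [Gt, Ga, Gt'] = cls (apow (int p))"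
proof -
  have "cls [Gt, Ga, Gt'] = cls ([Gt, Ga, Gt'] @ apow (- int p) @ apow (int p))"
    using grp_cls_context[OF apow_add[of "- int p" "int p"], of "[Gt, Ga, Gt']" "[]"] by simp
  also have "\<dots> = cls (relator @ apow (int p))"
    using p_ge_3 by (simp add: relator_def apow_def)
  also have "\<dots> = cls (apow (int p))"
    using grp_cls_context[OF grp_cls_relator[of relator rels bs_inv], of "[]" "apow (int p)"]
    by (simp add: rels_eq)
  finally show ?thesis .
qed

lemma tat': "cls [Gt, Ga', Gt'] = cls (apow (- int p))"
proof -
  have "cls [Gt, Ga', Gt'] = cls ([Gt, Ga', Gt'] @ apow (int p) @ apow (- int p))"
    using grp_cls_context[OF apow_add[of "int p" "- int p"], of "[Gt, Ga', Gt']" "[]"] by simp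
  also have "\<dots> = cls ([Gt, Ga', Gt'] @ [Gt, Ga, Gt'] @ apow (- int p))"
    using grp_cls_context[OF tat, of "[Gt, Ga', Gt']" "apow (- int p)"] by simp
  also have "\<dots> = cls ([Gt, Ga'] @ [Ga, Gt'] @ apow (- int p))"
    using cls_cancel'[of "[Gt, Ga']" Gt "[Ga, Gt'] @ apow (- int p)"] by simp
  also have "\<dots> = cls ([Gt] @ [Gt'] @ apow (- int p))"
    using cls_cancel'[of "[Gt]" Ga "[Gt'] @ apow (- int p)"] by simp
  also have "\<dots> = cls (apow (- int p))"
    using cls_cancel[of "[]" Gt "apow (- int p)"] by simp
  finally show ?thesis .
qed

lemma conj_apow: "cls ([Gt] @ apow m @ [Gt']) = cls (apow (int p * m))"
proof (induction m rule: int_induct[where k = 0])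
  case base
  show ?case using cls_cancel[of "[]" Gt "[]"] by simp
next
  case (step1 i)
  then have "apow (i + 1) = apow i @ [Ga]" by (simp add: apow_succ_nonneg)
  then have "cls ([Gt] @ apow (i + 1) @ [Gt']) = cls (([Gt] @ apow i @ [Gt']) @ [Gt, Ga, Gt'])"
    using cls_cancel'[of "[Gt] @ apow i" Gt "[Ga, Gt']"] by simp
  also have "\<dots> = cls (apow (int p * i) @ apow (int p))"
    by (rule grp_cls_append[OF step1(2) tat])
  also have "\<dots> = cls (apow (int p * (i + 1)))"
    by (simp add: apow_add algebra_simps)
  finally show ?case .
next
  case (step2 i)
  then have "apow (i - 1) = apow i @ [Ga']" by (simp add: apow_pred_nonpos)
  then have "cls ([Gt] @ apow (i - 1) @ [Gt']) = cls (([Gt] @ apow i @ [Gt']) @ [Gt, Ga', Gt'])"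
    using cls_cancel'[of "[Gt] @ apow i" Gt "[Ga', Gt']"] by simp
  also have "\<dots> = cls (apow (int p * i) @ apow (- int p))"
    by (rule grp_cls_append[OF step2(2) tat'])
  also have "\<dots> = cls (apow (int p * (i - 1)))"
    by (simp add: apow_add algebra_simps)
  finally show ?case .
qed

lemma Gt_apow: "cls ([Gt] @ apow m) = cls (apow (int p * m) @ [Gt])"
  using grp_cls_context[OF conj_apow[of m], of "[]" "[Gt]"]
    cls_cancel'[of "[Gt] @ apow m" Gt "[]"] by simp

lemma apow_Gt': "cls (apow m @ [Gt']) = cls ([Gt'] @ apow (int p * m))"
  using grp_cls_context[OF conj_apow[of m], of "[Gt']" "[]"]
    cls_cancel'[of "[]" Gt "apow m @ [Gt']"] by simp

lemma replicate_Gt_apow: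
  "cls (replicate j Gt @ apow m) = cls (apow (int p ^ j * m) @ replicate j Gt)"
proof (induction j arbitrary: m)
  case (Suc j)
  have "cls (replicate (Suc j) Gt @ apow m) = cls (replicate j Gt @ ([Gt] @ apow m) @ [])"
    by (simp flip: replicate_append_same)
  also have "\<dots> = cls (replicate j Gt @ (apow (int p * m) @ [Gt]) @ [])"
    by (rule grp_cls_context[OF Gt_apow])
  also have "\<dots> = cls ((apow (int p ^ j * (int p * m)) @ replicate j Gt) @ [Gt])"
    using grp_cls_append[OF Suc.IH[of "int p * m"] refl[of "cls [Gt]"]] by simp
  also have "\<dots> = cls (apow (int p ^ Suc j * m) @ replicate (Suc j) Gt)"
    by (simp add: replicate_append_same mult_ac)
  finally show ?case .
qed simp

text \<open>By \<open>Gt_apow\<close> and \<open>apow_Gt'\<close>, a letter t moves right and t^-1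
  moves left past any power of a, while the opposite moves would need an exponent divisible by p.
  This dictates the order of the three blocks.\<close>

definition nform :: "nat \<Rightarrow> int \<Rightarrow> nat \<Rightarrow> bsgen list" where
  "nform i m j = replicate i Gt' @ apow m @ replicate j Gt"

lemma act_nform: "act (0, 0) (nform i m j) = (int j - int i, of_int m * pw (- int i))"
  by (simp add: nform_def act_replicate act_apow)

lemma nform_apow: "cls (nform i m j @ apow n) = cls (nform i (m + int p ^ j * n) j)"
proof -
  have "cls (nform i m j @ apow n)
      = cls (replicate i Gt' @ apow m @ (apow (int p ^ j * n) @ replicate j Gt))"
    using grp_cls_context[OF replicate_Gt_apow[of j n], of "replicate i Gt' @ apow m" "[]"]
    by (simp add: nform_def)
  also have "\<dots> = cls (nform i (m + int p ^ j * n) j)"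
    using grp_cls_context[OF apow_add[of m "int p ^ j * n"], of "replicate i Gt'" "replicate j Gt"]
    by (simp add: nform_def)
  finally show ?thesis .
qed

lemma nform_snoc: "\<exists>i' m' j'. cls (nform i m j @ [x]) = cls (nform i' m' j')"
proof (cases x)
  case Ga
  then show ?thesis using nform_apow[of i m j 1] by (auto simp: apow_def)
next
  case Ga'
  then show ?thesis using nform_apow[of i m j "-1"] by (auto simp: apow_def)
next
  case Gt
  then have "nform i m j @ [x] = nform i m (Suc j)"
    by (simp add: nform_def replicate_append_same)
  then show ?thesis by metis
next
  case x: Gt'
  show ?thesis
  proof (cases j)
    case 0
    have "cls (nform i m j @ [x]) = cls (replicate i Gt' @ ([Gt'] @ apow (int p * m)) @ [])"
      using grp_cls_context[OF apow_Gt'[of m], of "replicate i Gt'" "[]"] x 0 by (simp add: nform_def)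
    also have "\<dots> = cls (nform (Suc i) (int p * m) 0)"
      by (simp add: nform_def replicate_app_Cons_same)
    finally show ?thesis by blast
  next
    case (Suc j')
    then have "nform i m j @ [x] = nform i m j' @ [Gt, bs_inv Gt] @ []"
      using x by (simp add: nform_def flip: replicate_append_same)
    then have "cls (nform i m j @ [x]) = cls (nform i m j')"
      using cls_cancel[of "nform i m j'" Gt "[]"] by simp
    then show ?thesis by blast
  qed
qed

lemma ex_nform: "\<exists>i m j. cls w = cls (nform i m j)"
proof (induction w rule: rev_induct)
  case Nil
  have "cls [] = cls (nform 0 0 0)" by (simp add: nform_def)
  then show ?case by blast
next
  case (snoc x w)
  then obtain i m j where "cls w = cls (nform i m j)" by blast
  then have "cls (w @ [x]) = cls (nform i m j @ [x])"
    using grp_cls_append by blast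
  then show ?case using nform_snoc[of i m j x] by metis
qed

text \<open>Conjugating a^(p m) by t^-1 gives a^m. By \<open>nform_eq\<close> this is the only way
  in which normal forms fail to be unique.\<close>

lemma nform_stretch: "cls (nform (i + d) (int p ^ d * m) (j + d)) = cls (nform i m j)"
proof (induction d)
  case (Suc d)
  have "cls (nform (Suc i) (int p * m) (Suc j)) = cls (nform i m j)" for i m j
  proof -
    have "cls ([Gt'] @ apow (int p * m) @ [Gt]) = cls (apow m)"
      using grp_cls_context[OF Gt_apow[of m], of "[Gt']" "[]"] cls_cancel'[of "[]" Gt "apow m"]
      by simp
    from grp_cls_context[OF this, of "replicate i Gt'" "replicate j Gt"] show ?thesis
      by (simp add: nform_def replicate_app_Cons_same)
  qed
  from this[of "i + d" "int p ^ d * m" "j + d"] Suc show ?case by (simp add: mult.assoc)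
qed simp

text \<open>Faithfulness of the affine action: the map determines j - i and m * p^(-i), so of two
  normal forms with the same map, the one with larger i is a stretching of the other.\<close>

lemma nform_eq:
  assumes "act (0, 0) (nform i m j) = act (0, 0) (nform i' m' j')"
  shows "cls (nform i m j) = cls (nform i' m' j')"
proof -
  have main: "cls (nform i m j) = cls (nform i' m' j')"
    if eq: "act (0, 0) (nform i m j) = act (0, 0) (nform i' m' j')" and le: "i \<le> i'" for i m j i' m' j'
  proof -
    obtain d where d: "i' = i + d" using le le_Suc_ex by blast
    with eq have j: "j' = j + d" by (simp add: act_nform)
    have "of_int m * pw (- int i) = of_int m' * pw (- int (i + d))"
      using eq d by (simp add: act_nform)
    also have "pw (- int (i + d)) = pw (- int i) / real p ^ d"
      by (simp add: power_int_diff power_int_minus divide_inverse)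
    finally have "real_of_int m' = of_int m * real p ^ d"
      by (simp add: field_simps)
    then have "real_of_int m' = of_int (int p ^ d * m)" by simp
    then have "m' = int p ^ d * m" unfolding of_int_eq_iff .
    then show ?thesis using d j nform_stretch by simp
  qed
  show ?thesis
    using main[OF assms] main[OF assms[symmetric]] by (cases "i \<le> i'") auto
qed

lemma word_eq_iff: "(u, w) \<in> word_eq bs_inv rels \<longleftrightarrow> act (0, 0) u = act (0, 0) w"
proof
  assume uw: "act (0, 0) u = act (0, 0) w"
  obtain i m j i' m' j' where nf: "cls u = cls (nform i m j)" "cls w = cls (nform i' m' j')"
    using ex_nform by metis
  then have "act (0, 0) (nform i m j) = act (0, 0) (nform i' m' j')"
    using uw act_word_eq unfolding grp_cls_eq_iff by metis
  then show "(u, w) \<in> word_eq bs_inv rels"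
    unfolding grp_cls_eq_iff[symmetric] nf by (rule nform_eq)
qed (rule act_word_eq)

section \<open>Group elements as pairs of a height and a p-adic fraction\<close>

definition verts :: "(int \<times> real) set" where
  "verts = {(k, x). \<exists>n::nat. x * real p ^ n \<in> \<int>}"

definition el :: "int \<times> real \<Rightarrow> bsgen list set" where
  "el v = {w. act (0, 0) w = v}"

lemma cls_eq_el: "cls w = el (act (0, 0) w)"
  by (auto simp: grp_cls_def el_def word_eq_iff)

lemma act_verts:
  assumes "v \<in> verts" shows "act v w \<in> verts"
proof -
  have "step x v \<in> verts" if "v \<in> verts" for x v
  proof -
    obtain k y n where v: "v = (k, y)" "y * real p ^ n \<in> \<int>" using \<open>v \<in> verts\<close> by (auto simp: verts_def)
    define N where "N = n + nat \<bar>k\<bar>"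
    have y: "y * real p ^ N \<in> \<int>" using v by (simp add: N_def power_add mult.assoc[symmetric])
    have pk: "pw k * real p ^ N \<in> \<int>" by (rule pw_scaled_Ints) (simp add: N_def)
    have "(y + pw k) * real p ^ N \<in> \<int>" "(y - pw k) * real p ^ N \<in> \<int>"
      using y pk by (simp_all add: algebra_simps)
    then show ?thesis using v y by (cases x) (auto simp: verts_def)
  qed
  then show ?thesis using assms
    by (induction w arbitrary: v) auto
qed

lemma verts_reachable:
  assumes "v \<in> verts" shows "\<exists>w. act (0, 0) w = v"
proof -
  obtain k x n where v: "v = (k, x)" "x * real p ^ n \<in> \<int>" using assms by (auto simp: verts_def)
  then obtain m where m: "x * real p ^ n = of_int m" by (auto elim: Ints_cases)
  then have x: "x = of_int m * pw (- int n)"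
    by (simp add: power_int_minus field_simps)
  let ?w = "replicate n Gt' @ apow m @ (if 0 \<le> k + int n then replicate (nat (k + int n)) Gt
     else replicate (nat (- (k + int n))) Gt')"
  have "act (0, 0) ?w = v"
    using x v by (auto simp: act_replicate act_apow)
  then show ?thesis by blast
qed

lemma el_cls: "v \<in> verts \<Longrightarrow> \<exists>w. act (0, 0) w = v \<and> el v = cls w"
  using verts_reachable cls_eq_el by metis

lemma origin_verts [simp]: "(0, 0) \<in> verts" by (simp add: verts_def)

lemma grp_elems_eq: "grp_elems bs_inv rels = el ` verts"
proof -
  have "range cls = el ` range (act (0, 0))"
    using cls_eq_el by auto
  also have "range (act (0, 0)) = verts"
    using verts_reachable act_verts[OF origin_verts] by (intro equalityI subsetI) (auto intro: rangeI, metis rangeI)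
  finally show ?thesis by (simp add: grp_elems_def)
qed

lemma grp_mult_el: "v \<in> verts \<Longrightarrow> grp_mult bs_inv rels (el v) w = el (act v w)"
  using el_cls[of v] grp_mult_cls[of bs_inv rels _ w] cls_eq_el by (metis act_append)

lemma el_inj: "u \<in> verts \<Longrightarrow> el u = el v \<Longrightarrow> u = v"
  using verts_reachable[of u] by (auto simp: el_def)

lemma grp_id_eq: "grp_id bs_inv rels = el (0, 0)"
  by (simp add: grp_id_def cls_eq_el)

section \<open>Word length\<close>

definition len :: "int \<times> real \<Rightarrow> nat" where "len v = word_length (el v)"

lemma len_le: "act (0, 0) w = v \<Longrightarrow> len v \<le> length w"
  unfolding len_def word_length_def by (rule Least_le) (auto simp: el_def)

lemma ex_geodesic:
  assumes "v \<in> verts" obtains w where "act (0, 0) w = v" "length w = len v"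
proof -
  obtain w where "act (0, 0) w = v" using verts_reachable[OF assms] by blast
  then have "\<exists>n. \<exists>w\<in>el v. length w = n" by (auto simp: el_def)
  from LeastI_ex[OF this] show ?thesis
    using that unfolding len_def word_length_def by (auto simp: el_def)
qed

lemma len_act: "v \<in> verts \<Longrightarrow> len (act v w) \<le> len v + length w"
  by (metis act_append ex_geodesic len_le length_append)

lemma len_act':
  assumes "v \<in> verts" shows "len v \<le> len (act v w) + length w"
proof -
  have "act (act v w) (rev (map bs_inv w)) = v" for v w
    by (induction w arbitrary: v) auto
  then show ?thesis using len_act[of "act v w" "rev (map bs_inv w)"] act_verts[OF assms, of w] by simp
qed

text \<open>In a geodesic word for v, N counts the letters a and a^-1, H the letters t, and L the
  letters t^-1. The height always stays between -L and H, so each letter a or a^-1 changes the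
  coordinate by at most p^H and by a multiple of p^(-L).\<close>

lemma len_lower:
  assumes "v \<in> verts"
  obtains N H L :: nat where "\<bar>snd v\<bar> \<le> real N * real p ^ H" "snd v * real p ^ L \<in> \<int>"
    "- int L \<le> fst v" "fst v \<le> int H" "N + H + L \<le> len v"
proof -
  have "\<exists>N H L :: nat. \<bar>snd (act (0, 0) w)\<bar> \<le> real N * real p ^ H \<and>
    snd (act (0, 0) w) * real p ^ L \<in> \<int> \<and> - int L \<le> fst (act (0, 0) w) \<and>
    fst (act (0, 0) w) \<le> int H \<and> N + H + L \<le> length w" for w
  proof (induction w rule: rev_induct)
    case (snoc g w)
    obtain k x where v: "act (0, 0) w = (k, x)" by fastforce
    with snoc obtain N H L :: nat where *: "\<bar>x\<bar> \<le> real N * real p ^ H"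
       "x * real p ^ L \<in> \<int>" "- int L \<le> k" "k \<le> int H" "N + H + L \<le> length w" by auto
    have le: "pw k \<le> real p ^ H"
      using power_int_increasing[of k "int H" "real p"] * p_ge_3 by simp
    have int: "pw k * real p ^ L \<in> \<int>" by (rule pw_scaled_Ints) (use * in simp)
    have mono: "real N * real p ^ H \<le> real N * real p ^ Suc H"
      using p_ge_3 by (intro mult_left_mono power_increasing) auto
    have pos: "0 \<le> pw k" by simp
    have N: "real (Suc N) * real p ^ H = real N * real p ^ H + real p ^ H" by (simp add: algebra_simps)
    show ?case
    proof (cases g)
      case Ga
      have "\<bar>x + pw k\<bar> \<le> real (Suc N) * real p ^ H"
        using * le pos N by linarith
      moreover have "(x + pw k) * real p ^ L \<in> \<int>" using * int by (simp add: distrib_right)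
      ultimately show ?thesis using * v Ga by (intro exI[of _ "Suc N"] exI[of _ H] exI[of _ L]) auto
    next
      case Ga'
      have "\<bar>x - pw k\<bar> \<le> real (Suc N) * real p ^ H"
        using * le pos N by linarith
      moreover have "(x - pw k) * real p ^ L \<in> \<int>" using * int by (simp add: left_diff_distrib)
      ultimately show ?thesis using * v Ga' by (intro exI[of _ "Suc N"] exI[of _ H] exI[of _ L]) auto
    next
      case Gt
      show ?thesis using * v Gt mono
        by (intro exI[of _ "N"] exI[of _ "Suc H"] exI[of _ L]) (auto intro: order_trans)
    next
      case Gt'
      have "x * real p ^ Suc L = (x * real p ^ L) * of_int (int p)" by simp
      also have "\<dots> \<in> \<int>" by (rule Ints_mult[OF *(2)]) simp
      finally show ?thesis using * v Gt'
        by (intro exI[of _ "N"] exI[of _ H] exI[of _ "Suc L"]) auto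
    qed
  qed auto
  then show ?thesis using that ex_geodesic[OF assms] by metis
qed

text \<open>The bound is attained by \<open>a ^ d\<^sub>0 t a ^ d\<^sub>1 t \<dots> t a ^ d\<^sub>r t ^ - r\<close>, where the \<open>d\<^sub>i\<close> are the digits
  of \<open>m\<close> in base \<open>p\<close>, chosen of absolute value at most \<open>p div 2\<close>.\<close>

lemma short_apow:
  "\<bar>m\<bar> \<le> int p ^ r \<Longrightarrow> \<exists>w. length w \<le> (p div 2 + 2) * r + 1 \<and> (\<forall>k x. act (k, x) w = (k, x + of_int m * pw k))"
proof (induction r arbitrary: m)
  case 0
  then have "length (apow m) \<le> 1" by (simp add: length_apow)
  then show ?case using act_apow by (intro exI[of _ "apow m"]) simp
next
  case (Suc r)
  let ?h = "int (p div 2)"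
  \<comment> \<open>Adding \<open>?h\<close> before dividing rounds to a nearest multiple of p, so
    the remainder d is a balanced digit. Since \<bar>d\<bar> < p, the quotient exceeds p^r in
    absolute value by less than 1, hence not at all.\<close>
  define m' where "m' = (m + ?h) div int p"
  define d where "d = m - int p * m'"
  have hp: "int p \<le> 2 * ?h + 1" "2 * ?h \<le> int p" "0 < int p" using p_ge_3 by linarith+
  have "d = (m + ?h) mod int p - ?h" unfolding d_def m'_def minus_div_mult_eq_mod[symmetric] by (simp add: algebra_simps)
  moreover have "0 \<le> (m + ?h) mod int p" "(m + ?h) mod int p < int p" using hp by auto
  ultimately have d: "\<bar>d\<bar> \<le> ?h" using hp by linarith
  have "\<bar>m'\<bar> \<le> int p ^ r"
  proof -
    have "int p * m' \<le> int p * int p ^ r + ?h" "- (int p * int p ^ r) - ?h \<le> int p * m'"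
      using Suc.prems d unfolding d_def by auto
    then have "int p * m' < int p * (int p ^ r + 1)" "int p * (- (int p ^ r) - 1) < int p * m'"
      using hp p_ge_3 by (simp_all add: algebra_simps)
    then show ?thesis using hp by (simp add: mult_less_cancel_left)
  qed
  then obtain w where w: "length w \<le> (p div 2 + 2) * r + 1" "\<And>k x. act (k, x) w = (k, x + of_int m' * pw k)"
    using Suc.IH by blast
  have "length (apow d @ [Gt] @ w @ [Gt']) \<le> (p div 2 + 2) * Suc r + 1"
    using w(1) d by (simp add: length_apow)
  moreover have "act (k, x) (apow d @ [Gt] @ w @ [Gt']) = (k, x + of_int m * pw k)" for k x
    by (simp add: act_apow w(2) pw_Suc d_def) (simp add: algebra_simps)
  ultimately show ?case by blast
qed

text \<open>Descend K levels, where the coordinate becomes the integer m, write a^m by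
  \<open>short_apow\<close>, and climb the k + K levels to the target.\<close>

lemma len_upper:
  fixes K r :: nat
  assumes "\<bar>m\<bar> \<le> int p ^ r" "- int K \<le> k"
  shows "int (len (k, of_int m * pw (- int K))) \<le> 2 * int K + (int (p div 2) + 2) * int r + 1 + k"
proof -
  obtain w where w: "length w \<le> (p div 2 + 2) * r + 1" "\<And>k x. act (k, x) w = (k, x + of_int m * pw k)"
    using short_apow assms by blast
  let ?w = "replicate K Gt' @ w @ replicate (nat (k + int K)) Gt"
  have "act (0, 0) ?w = (k, of_int m * pw (- int K))"
    using assms by (simp add: act_replicate w)
  then have "len (k, of_int m * pw (- int K)) \<le> length ?w" by (rule len_le)
  also have "length ?w \<le> K + ((p div 2 + 2) * r + 1) + nat (k + int K)" using w(1) by simp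
  finally have "int (len (k, of_int m * pw (- int K))) \<le> int (K + ((p div 2 + 2) * r + 1) + nat (k + int K))"
    by (rule of_nat_mono)
  then show ?thesis using assms by (simp add: algebra_simps)
qed

end

section \<open>Cayley complexes\<close>

lemma cc_eq_refl: "(P, P) \<in> cc_eq ginv R"
  by (simp add: cc_eq_def)

lemma cc_eq_sym: "(P, Q) \<in> cc_eq ginv R \<Longrightarrow> (Q, P) \<in> cc_eq ginv R"
  unfolding cc_eq_def by (meson sym_Un_converse sym_rtrancl symD)

lemma cc_eq_trans: "(P, Q) \<in> cc_eq ginv R \<Longrightarrow> (Q, T) \<in> cc_eq ginv R \<Longrightarrow> (P, T) \<in> cc_eq ginv R"
  unfolding cc_eq_def by (rule rtrancl_trans)

lemma cc_cls_eq_iff: "cc_cls ginv R P = cc_cls ginv R Q \<longleftrightarrow> (P, Q) \<in> cc_eq ginv R"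
  unfolding cc_cls_def using cc_eq_refl cc_eq_sym cc_eq_trans
  by (smt (verit, best) Image_singleton_iff subsetI subset_antisym)

lemma cc_cls_mem: "Q \<in> cc_cls ginv R P \<longleftrightarrow> (P, Q) \<in> cc_eq ginv R"
  by (simp add: cc_cls_def)

lemma cc_cls_glue: "(P, Q) \<in> cc_glue ginv R \<Longrightarrow> cc_cls ginv R P = cc_cls ginv R Q"
  unfolding cc_cls_eq_iff by (auto simp: cc_eq_def)

lemma openin_cc_top: "openin (cc_top ginv R) = cc_open ginv R"
  by (simp add: cc_top_def istopology_cc_open)

lemma cc_cls_in_cc_X:
  assumes "g \<in> grp_elems ginv R"
  shows "cc_cls ginv R (RV g) \<in> cc_X ginv R"
    and "0 \<le> s \<Longrightarrow> s \<le> 1 \<Longrightarrow> cc_cls ginv R (RE g x s) \<in> cc_X ginv R"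
    and "i < length R \<Longrightarrow> cmod z \<le> 1 \<Longrightarrow> cc_cls ginv R (RF g i z) \<in> cc_X ginv R"
  using assms unfolding cc_X_def raw_pts_def by blast+

lemma topspace_cc_top: "topspace (cc_top ginv R) = cc_X ginv R"
proof -
  have "cc_open ginv R (cc_X ginv R)"
    unfolding cc_open_def
  proof (intro conjI ballI allI impI)
    fix g and x :: 'a assume "g \<in> grp_elems ginv R"
    then have "{s \<in> {0..1}. cc_cls ginv R (RE g x s) \<in> cc_X ginv R} = {0..1}"
      by (auto intro: cc_cls_in_cc_X)
    then show "openin (top_of_set {0..1}) {s \<in> {0..1}. cc_cls ginv R (RE g x s) \<in> cc_X ginv R}"
      by simp
  next
    fix g i assume "g \<in> grp_elems ginv R" "i < length R"
    then have "{z \<in> cball 0 1. cc_cls ginv R (RF g i z) \<in> cc_X ginv R} = cball 0 1"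
      by (auto intro: cc_cls_in_cc_X)
    then show "openin (top_of_set (cball 0 1)) {z \<in> cball 0 1. cc_cls ginv R (RF g i z) \<in> cc_X ginv R}"
      by (simp only: openin_subtopology_self)
  qed simp
  moreover have "V \<subseteq> cc_X ginv R" if "cc_open ginv R V" for V
    using that by (simp add: cc_open_def)
  ultimately show ?thesis
    unfolding topspace_def openin_cc_top by auto
qed

lemma cc_X1_subset_cc_X: "cc_X1 ginv R \<subseteq> cc_X ginv R"
  unfolding cc_X1_def cc_X_def raw_pts_def by blast

lemma continuous_map_edge:
  assumes "g \<in> grp_elems ginv R"
  shows "continuous_map (top_of_set {0..1}) (cc_top ginv R) (\<lambda>s. cc_cls ginv R (RE g x s))"
  unfolding continuous_map_def topspace_cc_top openin_cc_top
  using assms by (auto intro: cc_cls_in_cc_X simp: cc_open_def)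

lemma continuous_map_face:
  assumes "g \<in> grp_elems ginv R" "i < length R"
  shows "continuous_map (top_of_set (cball 0 1)) (cc_top ginv R) (\<lambda>z. cc_cls ginv R (RF g i z))"
  unfolding continuous_map_def topspace_cc_top openin_cc_top
  using assms by (auto intro: cc_cls_in_cc_X simp: cc_open_def)

text \<open>A product with a discrete factor plays the role of a disjoint union, here of closed
  edges, so continuity can be checked on each summand.\<close>

lemma continuous_map_prod_discrete:
  assumes "\<And>a. a \<in> A \<Longrightarrow> continuous_map Z Y (\<lambda>s. f (a, s))"
  shows "continuous_map (prod_topology (discrete_topology A) Z) Y f"
proof -
  have "openin (prod_topology (discrete_topology A) Z) {x \<in> A \<times> topspace Z. f x \<in> U}" if U: "openin Y U" for U
  proof -
    have "{x \<in> A \<times> topspace Z. f x \<in> U} = (\<Union>a\<in>A. {a} \<times> {s \<in> topspace Z. f (a, s) \<in> U})"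
      by auto
    moreover have "openin (prod_topology (discrete_topology A) Z) ({a} \<times> {s \<in> topspace Z. f (a, s) \<in> U})"
      if "a \<in> A" for a
      using that openin_continuous_map_preimage[OF assms[OF that] U] by (simp add: openin_prod_Times_iff)
    ultimately show ?thesis by auto
  qed
  moreover have "f x \<in> topspace Y" if "x \<in> A \<times> topspace Z" for x
    using that assms[THEN continuous_map_image_subset_topspace] by (cases x) auto
  ultimately show ?thesis by (auto simp: continuous_map_def)
qed

lemma continuous_map_discrete_prod_assoc:
  assumes "\<And>a. a \<in> A \<Longrightarrow> continuous_map (prod_topology Z W) Y (\<lambda>(s, t). f ((a, s), t))"
  shows "continuous_map (prod_topology (prod_topology (discrete_topology A) Z) W) Y f"
proof -
  let ?D = "prod_topology (discrete_topology A) (prod_topology Z W)"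
  have "continuous_map ?D Y (\<lambda>(a, s, t). f ((a, s), t))"
    by (rule continuous_map_prod_discrete) (use assms in auto)
  moreover have "continuous_map (prod_topology (prod_topology (discrete_topology A) Z) W) ?D
      (\<lambda>q. (fst (fst q), snd (fst q), snd q))"
    by (intro continuous_map_pairedI continuous_map_snd
      continuous_map_compose[OF continuous_map_fst continuous_map_fst, unfolded o_def]
      continuous_map_compose[OF continuous_map_fst continuous_map_snd, unfolded o_def])
  ultimately have "continuous_map (prod_topology (prod_topology (discrete_topology A) Z) W) Y
      ((\<lambda>(a, s, t). f ((a, s), t)) \<circ> (\<lambda>q. (fst (fst q), snd (fst q), snd q)))"
    by (rule continuous_map_compose[rotated])
  then show ?thesis by (simp add: o_def)
qed

section \<open>Points of the Cayley complex of a Baumslag--Solitar group\<close>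

context baumslag_solitar
begin

abbreviation X :: "(bsgen list set, bsgen) cell_pt set topology" where "X \<equiv> cc_top bs_inv rels"
abbreviation X1 :: "(bsgen list set, bsgen) cell_pt set set" where "X1 \<equiv> cc_X1 bs_inv rels"
abbreviation lev :: "(bsgen list set, bsgen) cell_pt set \<Rightarrow> real" where "lev \<equiv> cc_lev bs_inv rels"
abbreviation gm :: "bsgen list set \<Rightarrow> bsgen list \<Rightarrow> bsgen list set" where "gm \<equiv> grp_mult bs_inv rels"

definition pV :: "int \<times> real \<Rightarrow> (bsgen list set, bsgen) cell_pt set" where
  "pV v = cc_cls bs_inv rels (RV (el v))"

definition pE :: "int \<times> real \<Rightarrow> bsgen \<Rightarrow> real \<Rightarrow> (bsgen list set, bsgen) cell_pt set" where
  "pE v x s = cc_cls bs_inv rels (RE (el v) x s)"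

definition pF :: "int \<times> real \<Rightarrow> complex \<Rightarrow> (bsgen list set, bsgen) cell_pt set" where
  "pF v z = cc_cls bs_inv rels (RF (el v) 0 z)"

lemma rels_nth [simp]: "rels ! 0 = relator" "length rels = Suc 0" by (simp_all add: rels_eq)

text \<open>The boundary circle is measured so that each letter of \<open>relator\<close> occupies
  one unit, which makes its circumference p + 3.\<close>

definition arc :: "real \<Rightarrow> complex" where
  "arc \<theta> = cis (2 * pi * \<theta> / (real p + 3))"

lemma step_verts: "v \<in> verts \<Longrightarrow> step x v \<in> verts"
  using act_verts[of v "[x]"] by simp

lemma el_in_grp_elems: "v \<in> verts \<Longrightarrow> el v \<in> grp_elems bs_inv rels"
  by (simp add: grp_elems_eq)

lemma pE_0: "v \<in> verts \<Longrightarrow> pE v x 0 = pV v"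
  unfolding pE_def pV_def by (rule cc_cls_glue) (auto simp: cc_glue_def el_in_grp_elems)

lemma pE_1: "v \<in> verts \<Longrightarrow> pE v x 1 = pV (step x v)"
  using grp_mult_el[of v "[x]"] el_in_grp_elems[of v]
  unfolding pE_def pV_def by (intro cc_cls_glue) (auto simp: cc_glue_def)

lemma pE_inv: "v \<in> verts \<Longrightarrow> 0 \<le> s \<Longrightarrow> s \<le> 1 \<Longrightarrow> pE v x s = pE (step x v) (bs_inv x) (1 - s)"
  using grp_mult_el[of v "[x]"] el_in_grp_elems[of v]
  unfolding pE_def by (intro cc_cls_glue) (auto simp: cc_glue_def)

lemma pF_arc:
  assumes "v \<in> verts" "j < p + 3" "0 \<le> u" "u \<le> 1"
  shows "pF v (arc (real j + u)) = pE (act v (take j relator)) (relator ! j) u"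
proof -
  have "(RF (el v) 0 (cis (2 * pi * (real j + u) / real (length (rels ! 0)))),
     RE (gm (el v) (take j (rels ! 0))) (rels ! 0 ! j) u) \<in> cc_glue bs_inv rels"
    using assms el_in_grp_elems[of v] unfolding cc_glue_def
    by (intro UnI2) (auto simp: length_relator)
  then have "(RF (el v) 0 (arc (real j + u)), RE (el (act v (take j relator))) (relator ! j) u)
     \<in> cc_glue bs_inv rels"
    using assms by (simp add: length_relator arc_def grp_mult_el add.commute)
  then show ?thesis
    unfolding pF_def pE_def by (rule cc_cls_glue)
qed

lemma cmod_arc [simp]: "cmod (arc \<theta>) = 1"
  by (simp add: arc_def)

lemma arc_periodic: "arc (real p + 3 - \<theta>) = arc (- \<theta>)"
proof -
  have "2 * pi * (real p + 3 - \<theta>) / (real p + 3) = 2 * pi * (- \<theta>) / (real p + 3) + 2 * pi"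
    by (simp add: field_simps)
  then show ?thesis unfolding arc_def by (simp only: cis_mult[symmetric] cis_2pi mult_1_right)
qed

definition arcpos :: "complex \<Rightarrow> real" where
  "arcpos z = (real p + 3) * (Arg2pi z / (2 * pi))"

lemma arcpos_arc: "0 \<le> \<theta> \<Longrightarrow> \<theta> < real p + 3 \<Longrightarrow> arcpos (arc \<theta>) = \<theta>"
proof -
  assume \<theta>: "0 \<le> \<theta>" "\<theta> < real p + 3"
  have "2 * pi * (\<theta> / (real p + 3)) < 2 * pi * 1"
    using \<theta> by (intro mult_strict_left_mono) (auto simp: field_simps)
  then have "Arg2pi (arc \<theta>) = 2 * pi * \<theta> / (real p + 3)"
    using \<theta> by (intro Arg2pi_unique[where r = 1]) (auto simp: arc_def cis_conv_exp)
  then show ?thesis by (simp add: arcpos_def)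
qed

lemma arc_arcpos:
  assumes "cmod z = 1"
  shows "arc (arcpos z) = z" "0 \<le> arcpos z" "arcpos z < real p + 3"
proof -
  have "2 * pi * arcpos z / (real p + 3) = Arg2pi z" by (simp add: arcpos_def add_pos_pos)
  then show "arc (arcpos z) = z"
    using Arg2pi_eq[of z] assms by (simp add: arc_def cis_conv_exp)
  show "0 \<le> arcpos z" using Arg2pi_ge_0[of z] by (simp add: arcpos_def)
  have "(real p + 3) * (Arg2pi z / (2 * pi)) < (real p + 3) * 1"
    using Arg2pi_lt_2pi[of z] by (intro mult_strict_left_mono) auto
  then show "arcpos z < real p + 3" by (simp add: arcpos_def)
qed

lemma arc_cases:
  assumes "cmod z = 1"
  obtains j u where "j < p + 3" "0 \<le> u" "u < 1" "z = arc (real j + u)"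
proof
  show "nat \<lfloor>arcpos z\<rfloor> < p + 3" using arc_arcpos[OF assms] by linarith
  show "0 \<le> arcpos z - real (nat \<lfloor>arcpos z\<rfloor>)" "arcpos z - real (nat \<lfloor>arcpos z\<rfloor>) < 1"
    using arc_arcpos[OF assms] by linarith+
  show "z = arc (real (nat \<lfloor>arcpos z\<rfloor>) + (arcpos z - real (nat \<lfloor>arcpos z\<rfloor>)))"
    using arc_arcpos[OF assms] by simp
qed

text \<open>\<open>nf\<close> picks a representative from each gluing class; it separates the classes.\<close>

definition nfE :: "bsgen list set \<Rightarrow> bsgen \<Rightarrow> real \<Rightarrow> (bsgen list set, bsgen) cell_pt" where
  "nfE g x s = (if s = 0 then RV g else if s = 1 then RV (gm g [x])
     else if x = Ga \<or> x = Gt then RE g x s else RE (gm g [x]) (bs_inv x) (1 - s))"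

fun nf :: "(bsgen list set, bsgen) cell_pt \<Rightarrow> (bsgen list set, bsgen) cell_pt" where
  "nf (RV g) = RV g"
| "nf (RE g x s) = nfE g x s"
| "nf (RF g i z) = (if cmod z < 1 then RF g i z
     else let j = nat \<lfloor>arcpos z\<rfloor> in nfE (gm g (take j relator)) (relator ! j) (arcpos z - real j))"

lemma nf_glue:
  assumes "(P, Q) \<in> cc_glue bs_inv rels"
  shows "nf P = nf Q"
proof -
  consider (0) v x where "v \<in> verts" "P = RE (el v) x 0" "Q = RV (el v)"
    | (1) v x where "v \<in> verts" "P = RE (el v) x 1" "Q = RV (gm (el v) [x])"
    | (2) v x s where "v \<in> verts" "P = RE (el v) x s" "Q = RE (gm (el v) [x]) (bs_inv x) (1 - s)"
    | (3) v j u where "v \<in> verts" "P = RF (el v) 0 (arc (real j + u))" "0 \<le> u" "u \<le> 1" "j < p + 3"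
        "Q = RE (gm (el v) (take j relator)) (relator ! j) u"
    using assms unfolding cc_glue_def grp_elems_eq
    by (elim UnE CollectE exE conjE) (auto simp: length_relator arc_def add.commute)
  then show ?thesis
  proof cases
    case 2
    then have "gm (gm (el v) [x]) [bs_inv x] = el v"
      by (simp add: grp_mult_el step_verts)
    then show ?thesis using 2 by (cases x) (auto simp: nfE_def)
  next
    case 3
    show ?thesis
    proof (cases "u < 1")
      case True
      then have pos: "arcpos (arc (real j + u)) = real j + u" using 3 by (intro arcpos_arc) auto
      moreover have "nat \<lfloor>real j + u\<rfloor> = j" using True 3 by linarith
      ultimately show ?thesis using 3 by (simp add: Let_def)
    next
      case False
      then have u: "u = 1" using 3 by simp
      have Q: "nf Q = RV (el (act v (take (Suc j) relator)))"
        using 3 u by (simp add: nfE_def grp_mult_el act_verts take_Suc_conv_app_nth length_relator)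
      show ?thesis
      proof (cases "Suc j < p + 3")
        case True
        then have pos: "arcpos (arc (real j + u)) = real (Suc j)" using u by (subst arcpos_arc) auto
        then show ?thesis using Q 3 by (simp add: Let_def nfE_def grp_mult_el del: of_nat_Suc)
      next
        case False
        \<comment> \<open>The last arc closes up at the base point of the circle, where
          \<open>arcpos\<close> jumps back to 0. Both readings give the vertex v because
          \<open>relator\<close> acts trivially.\<close>
        then have "real j + u = real p + 3 - 0" "Suc j = length relator" using 3 u by (auto simp: length_relator)
        then have "arc (real j + u) = arc 0" "act v (take (Suc j) relator) = v"
          using arc_periodic[of 0] act_relator by simp_all
        moreover have "arcpos (arc 0) = 0" by (rule arcpos_arc) auto
        ultimately show ?thesis using Q 3 by (simp add: Let_def nfE_def grp_mult_el)
      qed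
    qed
  qed (auto simp: nfE_def)
qed

lemma nf_eq:
  assumes "(P, Q) \<in> cc_eq bs_inv rels"
  shows "nf P = nf Q"
  using assms unfolding cc_eq_def by (induction rule: rtrancl_induct) (use nf_glue in auto)

lemma cc_X1_eq: "X1 = {pE v x s | v x s. v \<in> verts \<and> 0 \<le> s \<and> s \<le> 1}"
proof (intro equalityI subsetI)
  fix P assume "P \<in> X1"
  then consider (v) v where "v \<in> verts" "P = pV v"
    | (e) v x s where "v \<in> verts" "0 \<le> s" "s \<le> 1" "P = pE v x s"
    unfolding cc_X1_def grp_elems_eq pV_def pE_def by blast
  then show "P \<in> {pE v x s | v x s. v \<in> verts \<and> 0 \<le> s \<and> s \<le> 1}"
  proof cases
    case v
    then have "P = pE v Ga 0" by (simp add: pE_0)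
    with v(1) show ?thesis by (intro CollectI exI[of _ v] exI[of _ Ga] exI[of _ "0::real"]) simp
  qed auto
next
  fix P assume "P \<in> {pE v x s | v x s. v \<in> verts \<and> 0 \<le> s \<and> s \<le> 1}"
  then obtain v x s where P: "v \<in> verts" "0 \<le> s" "s \<le> 1" "P = pE v x s"
    by (elim CollectE exE conjE)
  have "RE (el v) x s \<in> {RE g x s | g x s. g \<in> grp_elems bs_inv rels \<and> 0 \<le> s \<and> s \<le> 1}"
    using el_in_grp_elems[OF P(1)] P(2,3) by blast
  then show "P \<in> X1" unfolding cc_X1_def P(4) pE_def by (rule imageI[OF UnI2])
qed

lemma cc_X0_eq: "cc_X0 bs_inv rels = pV ` verts"
  unfolding cc_X0_def grp_elems_eq pV_def by blast

lemma pF_interior_inj: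
  assumes "pF v z = pF v' z'" "cmod z < 1" "cmod z' \<le> 1" "v \<in> verts"
  shows "v = v' \<and> z = z'"
proof -
  have "nf (RF (el v) 0 z) = nf (RF (el v') 0 z')"
    using assms nf_eq unfolding pF_def cc_cls_eq_iff by blast
  then have "el v = el v' \<and> z = z'"
    using assms by (auto simp: nfE_def Let_def split: if_splits)
  then show ?thesis using el_inj assms by blast
qed

lemma pF_interior_notin_X1:
  assumes "cmod z < 1"
  shows "pF v z \<notin> X1"
proof
  assume "pF v z \<in> X1"
  then obtain v' x s where "pF v z = pE v' x s" unfolding cc_X1_eq by blast
  then have "nf (RF (el v) 0 z) = nf (RE (el v') x s)"
    using assms nf_eq unfolding pF_def pE_def cc_cls_eq_iff by blast
  then show False using assms by (simp add: nfE_def split: if_splits)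
qed

lemma pE_in_X1: "v \<in> verts \<Longrightarrow> 0 \<le> s \<Longrightarrow> s \<le> 1 \<Longrightarrow> pE v x s \<in> X1"
  unfolding cc_X1_eq by blast

section \<open>Levels\<close>

lemma lev_pV:
  assumes "v \<in> verts"
  shows "lev (pV v) = real (len v)"
proof -
  have self: "el v \<in> grp_elems bs_inv rels \<and> RV (el v) \<in> pV v"
    using assms by (simp add: el_in_grp_elems pV_def cc_cls_mem cc_eq_refl)
  have "g = el v" if "RV g \<in> pV v" for g
    using that nf_eq[of "RV (el v)" "RV g"] by (simp add: pV_def cc_cls_mem)
  then have "(SOME g. g \<in> grp_elems bs_inv rels \<and> RV g \<in> pV v) = el v"
    using self by (intro some_equality) auto
  then show ?thesis using self by (auto simp: cc_lev_def len_def)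
qed

text \<open>The choice inside \<open>cc_lev\<close> may return the edge with either orientation. The
  mean of the lengths of the endpoints is the same for both.\<close>

lemma lev_pE:
  assumes "v \<in> verts" "0 < s" "s < 1"
  shows "lev (pE v x s) = (real (len v) + real (len (step x v))) / 2 + 1/4"
proof -
  let ?Q = "\<lambda>(g, y). \<exists>s'. g \<in> grp_elems bs_inv rels \<and> 0 < s' \<and> s' < 1 \<and> RE g y s' \<in> pE v x s"
  have nV: "\<not> (\<exists>g. g \<in> grp_elems bs_inv rels \<and> RV g \<in> pE v x s)"
    using nf_eq[of "RE (el v) x s"] assms by (fastforce simp: pE_def cc_cls_mem nfE_def split: if_splits)
  have self: "?Q (el v, x)"
    using assms by (auto simp: el_in_grp_elems pE_def cc_cls_mem intro: cc_eq_refl)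
  obtain g y where some: "(SOME q. ?Q q) = (g, y)" by fastforce
  then have "?Q (g, y)" using someI[of ?Q, OF self] by simp
  then obtain s' v' where s': "v' \<in> verts" "g = el v'" "0 < s'" "s' < 1" "(RE (el v) x s, RE g y s') \<in> cc_eq bs_inv rels"
    by (auto simp: pE_def cc_cls_mem grp_elems_eq)
  \<comment> \<open>The orientation that \<open>nfE\<close> selects: comparing oriented edges shows
    that the chosen edge is the given one or its reverse.\<close>
  define orient where "orient = (\<lambda>v x. if x = Ga \<or> x = Gt then (v, x) else (step x v, bs_inv x))"
  have "\<exists>r. nfE (el v) x s = RE (el (fst (orient v x))) (snd (orient v x)) r \<and> fst (orient v x) \<in> verts"
    if "v \<in> verts" "0 < s" "s < 1" for v x s
    using that by (auto simp: nfE_def orient_def grp_mult_el step_verts)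
  moreover have "nfE (el v) x s = nfE (el v') y s'" using nf_eq[OF s'(5)] s'(2) by simp
  ultimately have "orient v x = orient v' y"
    using assms s'(1,3,4) el_inj by (metis cell_pt.inject(2) prod_eqI)
  then have "v' = v \<and> y = x \<or> v' = step x v \<and> y = bs_inv x"
    unfolding orient_def by (metis bs_inv_inv step_inv(1) prod.inject)
  then have "real (word_length g) + real (word_length (gm g [y])) = real (len v) + real (len (step x v))"
    using s' by (auto simp: len_def grp_mult_el)
  moreover have "\<exists>g x' s'. g \<in> grp_elems bs_inv rels \<and> 0 < s' \<and> s' < 1 \<and> RE g x' s' \<in> pE v x s"
    using self by auto
  ultimately show ?thesis
    unfolding cc_lev_def by (simp only: nV if_False if_True some prod.case)
qed

lemma lev_pF:
  assumes "v \<in> verts" "cmod z < 1"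
  shows "lev (pF v z) = (\<Sum>j<p + 3. real (len (act v (take j relator)))) / (real p + 3) + 1/4 + 1 / cc_const rels"
proof -
  let ?Q = "\<lambda>(g, i). \<exists>z'. g \<in> grp_elems bs_inv rels \<and> i < length rels \<and> cmod z' < 1 \<and> RF g i z' \<in> pF v z"
  have nV: "\<not> (\<exists>g. g \<in> grp_elems bs_inv rels \<and> RV g \<in> pF v z)"
    using nf_eq[of "RF (el v) 0 z"] assms by (fastforce simp: pF_def cc_cls_mem nfE_def split: if_splits)
  have nE: "\<not> (\<exists>g x s. g \<in> grp_elems bs_inv rels \<and> 0 < s \<and> s < 1 \<and> RE g x s \<in> pF v z)"
    using nf_eq[of "RF (el v) 0 z"] assms by (fastforce simp: pF_def cc_cls_mem nfE_def split: if_splits)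
  have self: "?Q (el v, 0)"
    using assms by (auto simp: el_in_grp_elems pF_def cc_cls_mem intro: cc_eq_refl)
  have "q = (el v, 0)" if "?Q q" for q
    using that nf_eq[of "RF (el v) 0 z"] assms by (fastforce simp: pF_def cc_cls_mem nfE_def)
  then have "(SOME q. ?Q q) = (el v, 0)"
    using self by (intro some_equality) auto
  moreover have "lev (pF v z) = (case SOME q. ?Q q of (g, i) \<Rightarrow>
      (\<Sum>j < length (rels ! i). real (word_length (gm g (take j (rels ! i))))) / real (length (rels ! i))
        + 1/4 + 1 / cc_const rels)"
    unfolding cc_lev_def by (simp only: nV nE if_False)
  ultimately show ?thesis using assms(1)
    by (simp add: cc_lev_def length_relator grp_mult_el len_def add.commute)
qed

text \<open>A boundary vertex of the cell is reached from v by a prefix of \<open>relator\<close>,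
  so its length is within p + 3 of that of v. Averaging preserves this, and the added constants
  total less than 1. Points of the boundary circle have the level of their edge or vertex and are
  treated separately.\<close>

lemma lev_pF_bounds:
  assumes v: "v \<in> verts" and z: "cmod z \<le> 1"
  shows "real (len v) - (real p + 3) \<le> lev (pF v z)" "lev (pF v z) \<le> real (len v) + real p + 4" "0 \<le> lev (pF v z)"
proof -
  have near: "real (len v) - (real p + 3) \<le> real (len (act v (take j relator)))
    \<and> real (len (act v (take j relator))) \<le> real (len v) + (real p + 3)" for j
  proof -
    have "length (take j relator) \<le> p + 3" by (simp add: length_relator)
    with len_act[OF v, of "take j relator"] len_act'[OF v, of "take j relator"] show ?thesis by linarith
  qed
  have "real (len v) - (real p + 3) \<le> lev (pF v z) \<and> lev (pF v z) \<le> real (len v) + real p + 4 \<and> 0 \<le> lev (pF v z)"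
  proof (cases "cmod z < 1")
    case True
    let ?S = "\<Sum>j<p + 3. real (len (act v (take j relator)))"
    have "real (card {..<p+3}) * (real (len v) - (real p + 3)) \<le> ?S"
      by (rule sum_bounded_below) (use near in auto)
    moreover have "?S \<le> real (card {..<p+3}) * (real (len v) + (real p + 3))"
      by (rule sum_bounded_above) (use near in auto)
    moreover have "0 \<le> ?S" by (intro sum_nonneg) auto
    ultimately have "real (len v) - (real p + 3) \<le> ?S / (real p + 3)" "?S / (real p + 3) \<le> real (len v) + (real p + 3)"
      "0 \<le> ?S / (real p + 3)"
      by (simp_all add: field_simps)
    moreover have "4 \<le> cc_const rels" by (simp add: cc_const_def bs_rels_def)
    then have "0 \<le> 1 / cc_const rels" "1 / cc_const rels \<le> 1/4" by (simp_all add: field_simps)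
    ultimately show ?thesis using lev_pF[OF v True] by linarith
  next
    case False
    then have "cmod z = 1" using z by simp
    then obtain j u where ju: "j < p + 3" "0 \<le> u" "u < 1" "z = arc (real j + u)" by (rule arc_cases)
    let ?w = "act v (take j relator)"
    have w: "?w \<in> verts" by (rule act_verts[OF v])
    have z': "pF v z = pE ?w (relator ! j) u" using ju pF_arc[OF v] by simp
    have next_w: "step (relator ! j) ?w = act v (take (Suc j) relator)"
      using ju by (simp add: take_Suc_conv_app_nth length_relator)
    show ?thesis
    proof (cases "u = 0")
      case True
      then show ?thesis using lev_pV[OF w] near[of j] z' pE_0[OF w] by simp
    next
      case False
      then have "lev (pF v z) = (real (len ?w) + real (len (act v (take (Suc j) relator)))) / 2 + 1/4"
        using lev_pE[OF w] ju z' next_w by simp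
      moreover have "real (len v) - (real p + 3) \<le> real (len ?w)" "real (len ?w) \<le> real (len v) + (real p + 3)"
        "real (len v) - (real p + 3) \<le> real (len (act v (take (Suc j) relator)))"
        "real (len (act v (take (Suc j) relator))) \<le> real (len v) + (real p + 3)"
        using near[of j] near[of "Suc j"] by auto
      moreover have "0 \<le> real (len ?w)" "0 \<le> real (len (act v (take (Suc j) relator)))" by auto
      ultimately have "real (len v) - (real p + 3) \<le> lev (pF v z)" "lev (pF v z) \<le> real (len v) + real p + 4"
        "0 \<le> lev (pF v z)"
        by argo+
      then show ?thesis by simp
    qed
  qed
  then show "real (len v) - (real p + 3) \<le> lev (pF v z)" "lev (pF v z) \<le> real (len v) + real p + 4" "0 \<le> lev (pF v z)" by auto
qed

section \<open>The 1-skeleton as a quotient of its edges\<close>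

definition edges :: "(((int \<times> real) \<times> bsgen) \<times> real) topology" where
  "edges = prod_topology (discrete_topology (verts \<times> UNIV)) (top_of_set {0..1})"

lemma topspace_edges: "topspace edges = (verts \<times> UNIV) \<times> {0..1}"
  by (simp add: edges_def)

lemma continuous_map_pE: "v \<in> verts \<Longrightarrow> continuous_map (top_of_set {0..1}) X (pE v x)"
  unfolding pE_def by (rule continuous_map_edge[OF el_in_grp_elems])

lemma continuous_map_pF: "v \<in> verts \<Longrightarrow> continuous_map (top_of_set (cball 0 1)) X (pF v)"
  unfolding pF_def by (rule continuous_map_face[OF el_in_grp_elems]) auto

lemma continuous_arc: "continuous_on S arc"
  unfolding arc_def by (intro continuous_intros) auto

text \<open>A subset of the 1-skeleton whose traces on the edges are open is extended to an open set of the
  complex by adding to each face an open collar over the part of the boundary circle lying in the set.\<close>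

lemma open_collar:
  assumes U: "U \<subseteq> X1" and op: "\<And>v x. v \<in> verts \<Longrightarrow> openin (top_of_set {0..1}) {s \<in> {0..1}. pE v x s \<in> U}"
  shows "\<exists>V. openin X V \<and> U = V \<inter> X1"
proof -
  define V where "V = U \<union> {pF v z | v z. v \<in> verts \<and> 1/2 < cmod z \<and> cmod z < 1 \<and> pF v (sgn z) \<in> U}"
  have V_X1: "V \<inter> X1 = U" using U pF_interior_notin_X1 by (auto simp: V_def)
  have "cc_open bs_inv rels V"
    unfolding cc_open_def
  proof (intro conjI ballI allI impI)
    have "U \<subseteq> cc_X bs_inv rels" using U cc_X1_subset_cc_X by blast
    moreover have "pF v z \<in> cc_X bs_inv rels" if "v \<in> verts" "cmod z < 1" for v z
      unfolding pF_def using that by (intro cc_cls_in_cc_X) (auto simp: el_in_grp_elems)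
    ultimately show "V \<subseteq> cc_X bs_inv rels" by (auto simp: V_def)
  next
    fix g x assume "g \<in> grp_elems bs_inv rels"
    then obtain v where v: "v \<in> verts" "g = el v" by (auto simp: grp_elems_eq)
    then have "{s \<in> {0..1}. pE v x s \<in> V} = {s \<in> {0..1}. pE v x s \<in> U}"
      using V_X1 pE_in_X1[OF v(1), of _ x] U by auto
    then show "openin (top_of_set {0..1}) {s \<in> {0..1}. cc_cls bs_inv rels (RE g x s) \<in> V}"
      using op[of v x] v by (simp add: pE_def)
  next
    fix g i assume "g \<in> grp_elems bs_inv rels" "i < length rels"
    then obtain v where v: "v \<in> verts" "g = el v" "i = 0" by (auto simp: grp_elems_eq)
    define W where "W = {w \<in> sphere 0 1. pF v w \<in> U}"
    \<comment> \<open>A relatively open part of a closed arc need not be open in the circle, since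
      arcs share endpoints. The complements are therefore used: they are compact on each arc, and a
      finite union of them is closed.\<close>
    define C where "C j = (\<lambda>u. arc (real j + u)) ` {u \<in> {0..1}. pE (act v (take j relator)) (relator ! j) u \<notin> U}" for j
    have "compact (C j)" for j
    proof -
      have "closedin (top_of_set {0..1}) ({0..1} - {u \<in> {0..1}. pE (act v (take j relator)) (relator ! j) u \<in> U})"
        using op[OF act_verts[OF v(1)]] by (intro closedin_diff) auto
      moreover have "{0..1} - {u \<in> {0..1}. pE (act v (take j relator)) (relator ! j) u \<in> U}
          = {u \<in> {0..1}. pE (act v (take j relator)) (relator ! j) u \<notin> U}" by auto
      ultimately have "compact {u \<in> {0..1::real}. pE (act v (take j relator)) (relator ! j) u \<notin> U}"
        using closedin_compact[of "{0..1::real}"] by auto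
      then show ?thesis
        unfolding C_def
        by (intro compact_continuous_image continuous_on_compose2[OF continuous_arc[of UNIV]] continuous_intros) auto
    qed
    then have "closed (\<Union>j<p + 3. C j)" by (intro closed_UN) (auto intro: compact_imp_closed)
    moreover have "W = sphere 0 1 - (\<Union>j<p + 3. C j)"
    proof (intro equalityI subsetI)
      fix w assume "w \<in> W"
      then show "w \<in> sphere 0 1 - (\<Union>j<p + 3. C j)"
        using pF_arc[OF v(1)] by (auto simp: W_def C_def)
    next
      fix w assume w: "w \<in> sphere 0 1 - (\<Union>j<p + 3. C j)"
      then have "cmod w = 1" by simp
      then obtain j u where ju: "j < p + 3" "0 \<le> u" "u < 1" "w = arc (real j + u)" by (rule arc_cases)
      have "pE (act v (take j relator)) (relator ! j) u \<in> U"
      proof (rule ccontr)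
        assume "pE (act v (take j relator)) (relator ! j) u \<notin> U"
        then have "w \<in> C j" unfolding C_def \<open>w = _\<close> using ju by (intro imageI) simp
        then show False using w ju by blast
      qed
      then show "w \<in> W" using ju pF_arc[OF v(1)] by (simp add: W_def)
    qed
    ultimately have W: "openin (top_of_set (sphere 0 1)) W"
      by (metis Diff_eq openin_open_Int open_Compl)
    \<comment> \<open>The disc around 0 is removed because the radial projection \<open>sgn\<close>
      is discontinuous there.\<close>
    define A where "A = cball 0 1 \<inter> - cball (0::complex) (1/2)"
    have A: "openin (top_of_set (cball 0 1)) A"
      unfolding A_def by (intro openin_open_Int open_Compl closed_cball)
    have "continuous_on A sgn" unfolding sgn_div_norm A_def by (intro continuous_intros) auto
    moreover have "sgn \<in> A \<rightarrow> sphere 0 1" by (auto simp: A_def norm_sgn)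
    ultimately have "openin (top_of_set A) (A \<inter> sgn -` W)"
      using W by (rule continuous_openin_preimage)
    then have "openin (top_of_set (cball 0 1)) (A \<inter> sgn -` W)" using A openin_trans by blast
    moreover have "{z \<in> cball 0 1. pF v z \<in> V} = A \<inter> sgn -` W"
    proof -
      have "pF v z \<in> V \<longleftrightarrow> 1/2 < cmod z \<and> pF v (sgn z) \<in> U" if z: "cmod z \<le> 1" for z
      proof (cases "cmod z < 1")
        case True
        then have "pF v z \<notin> U" using U pF_interior_notin_X1 by blast
        then have "pF v z \<in> V \<longleftrightarrow> (\<exists>v' z'. pF v z = pF v' z' \<and> v' \<in> verts \<and> 1/2 < cmod z'
            \<and> cmod z' < 1 \<and> pF v' (sgn z') \<in> U)"
          unfolding V_def by blast
        then show ?thesis using True v(1) pF_interior_inj by (metis less_imp_le)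
      next
        case False
        then have "cmod z = 1" "sgn z = z" using z by (auto simp: sgn_div_norm)
        moreover have "pF v z \<noteq> pF v' z'" if "v' \<in> verts" "cmod z' < 1" for v' z'
          using pF_interior_inj[of v' z' v z] that z \<open>cmod z = 1\<close> by auto
        ultimately show ?thesis unfolding V_def by auto
      qed
      then show ?thesis by (auto simp: A_def W_def norm_sgn)
    qed
    ultimately show "openin (top_of_set (cball 0 1)) {z \<in> cball 0 1. cc_cls bs_inv rels (RF g i z) \<in> V}"
      using v by (simp add: pF_def)
  qed
  then show ?thesis using V_X1 openin_cc_top by metis
qed

text \<open>The hard direction is that a set with open traces on all edges is open in the subspace
  topology, which also involves the faces; \<open>open_collar\<close> supplies the extension into
  them.\<close>

lemma quotient_map_edges: "quotient_map edges (subtopology X X1) (\<lambda>((v, x), s). pE v x s)"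
proof -
  let ?f = "\<lambda>((v, x), s). pE v x s"
  have topX1: "topspace (subtopology X X1) = X1"
    using cc_X1_subset_cc_X by (auto simp: topspace_cc_top)
  have img: "?f ` topspace edges = X1"
    unfolding topspace_edges cc_X1_eq by force
  have cont: "continuous_map edges X ?f"
    unfolding edges_def by (rule continuous_map_prod_discrete) (auto simp: continuous_map_pE)
  have iff: "openin edges {q \<in> topspace edges. ?f q \<in> U} \<longleftrightarrow> openin (subtopology X X1) U" if U: "U \<subseteq> X1" for U
  proof
    assume op: "openin edges {q \<in> topspace edges. ?f q \<in> U}"
    have "openin (top_of_set {0..1}) {s \<in> {0..1}. pE v x s \<in> U}" if v: "v \<in> verts" for v x
    proof -
      have "continuous_map (top_of_set {0..1}) edges (\<lambda>s. ((v, x), s))"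
        unfolding edges_def using v by (intro continuous_map_pairedI) auto
      from openin_continuous_map_preimage[OF this op] show ?thesis
        using v by (simp add: topspace_edges conj_ac cong: conj_cong)
    qed
    from open_collar[OF U this] show "openin (subtopology X X1) U"
      by (auto simp: openin_subtopology)
  next
    assume "openin (subtopology X X1) U"
    moreover have "continuous_map edges (subtopology X X1) ?f"
      using cont img by (simp add: continuous_map_in_subtopology Pi_iff image_subset_iff_funcset flip: image_subset_iff)
    ultimately show "openin edges {q \<in> topspace edges. ?f q \<in> U}"
      using openin_continuous_map_preimage by blast
  qed
  show ?thesis unfolding quotient_map_def topX1 using img iff by auto
qed

text \<open>A quotient map times an identity need not be a quotient map. Here it is, because the
  unit interval is locally compact and Hausdorff.\<close>

lemma continuous_map_X1_times_I:
  assumes "\<And>v x. v \<in> verts \<Longrightarrow>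
    continuous_map (prod_topology (top_of_set {0..1}) (top_of_set {0..1::real})) X (\<lambda>(s, t). f (pE v x s) t)"
  shows "continuous_map (prod_topology (subtopology X X1) (top_of_set {0..1})) X (\<lambda>(P, t). f P t)"
proof -
  let ?I = "top_of_set {0..1::real}"
  have I: "locally_compact_space ?I" "Hausdorff_space ?I"
    by (auto intro!: compact_imp_locally_compact_space simp: compact_space_subtopology Hausdorff_space_subtopology)
  have quot: "quotient_map (prod_topology edges ?I) (prod_topology (subtopology X X1) ?I)
     (\<lambda>(q, t). ((\<lambda>((v, x), s). pE v x s) q, t))"
    using quotient_map_prod_left[OF I(1) disjI1[OF I(2)] quotient_map_edges] .
  have "continuous_map (prod_topology edges ?I) X ((\<lambda>(P, t). f P t) \<circ> (\<lambda>(q, t). ((\<lambda>((v, x), s). pE v x s) q, t)))"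
    unfolding edges_def by (rule continuous_map_discrete_prod_assoc) (use assms in auto)
  then show ?thesis using continuous_compose_quotient_map_eq[OF quot] by blast
qed

section \<open>Planes in the Cayley complex\<close>

definition p_fractions :: "real set" where "p_fractions = {x. \<exists>n::nat. x * real p ^ n \<in> \<int>}"

lemma verts_iff: "(k, x) \<in> verts \<longleftrightarrow> x \<in> p_fractions"
  by (simp add: verts_def p_fractions_def)

lemma p_fractions_0 [simp]: "0 \<in> p_fractions" by (simp add: p_fractions_def)

lemma p_fractions_shift: "x \<in> p_fractions \<Longrightarrow> x + of_int m * pw k \<in> p_fractions"
  using act_verts[of "(k, x)" "apow m"] by (simp add: verts_iff act_apow)

text \<open>The Coons patch of the boundary of the 2-cell, a square with one edge on top and \<open>p\<close> edges at
  the bottom. The patch may leave the unit disc; dividing by \<open>max 1 (cmod _)\<close> brings it back without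
  moving the boundary.\<close>

definition patch :: "real \<Rightarrow> real \<Rightarrow> complex" where
  "patch \<alpha> \<eta> = of_real (1 - \<eta>) * arc (- real p * \<alpha>) + of_real \<eta> * arc (1 + \<alpha>)
     + of_real (1 - \<alpha>) * arc \<eta> + of_real \<alpha> * arc (3 - \<eta>)
     - (of_real ((1 - \<alpha>) * (1 - \<eta>)) * arc 0 + of_real ((1 - \<alpha>) * \<eta>) * arc 1
       + of_real (\<alpha> * \<eta>) * arc 2 + of_real (\<alpha> * (1 - \<eta>)) * arc 3)"

definition disc :: "real \<Rightarrow> real \<Rightarrow> complex" where
  "disc \<alpha> \<eta> = patch \<alpha> \<eta> / of_real (max 1 (cmod (patch \<alpha> \<eta>)))"

lemma cmod_disc: "cmod (disc \<alpha> \<eta>) \<le> 1"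
  by (auto simp: disc_def norm_divide max_def field_simps)

lemma continuous_on_disc:
  assumes "continuous_on S f" "continuous_on S g"
  shows "continuous_on S (\<lambda>q. disc (f q) (g q))"
proof -
  have [continuous_intros]: "continuous_on S (\<lambda>q. arc (h q))" if "continuous_on S h" for h
    using continuous_on_compose2[OF continuous_arc[of UNIV] that] by simp
  have "continuous_on S (\<lambda>q. patch (f q) (g q))"
    unfolding patch_def by (intro continuous_intros assms)
  then show ?thesis unfolding disc_def by (intro continuous_intros) (auto simp: max_def)
qed

lemma disc_eq: "cmod (patch \<alpha> \<eta>) = 1 \<Longrightarrow> disc \<alpha> \<eta> = patch \<alpha> \<eta>"
  by (simp add: disc_def)

lemma arc_3: "arc (- real p) = arc 3"
  using arc_periodic[of "real p"] by simp

text \<open>The sides of the square follow the relator t a t^-1 a^-p: the left side upwards is its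
  first letter, the top its second, the right side downwards its third, and the bottom read from
  right to left its last p letters. On each side the corner terms of the patch cancel.\<close>

lemma disc_boundary:
  "disc 0 \<eta> = arc \<eta>" "disc 1 \<eta> = arc (3 - \<eta>)" "disc \<alpha> 0 = arc (- real p * \<alpha>)" "disc \<alpha> 1 = arc (1 + \<alpha>)"
proof -
  have 1: "patch 0 \<eta> = arc \<eta>" by (simp add: patch_def algebra_simps)
  have 2: "patch 1 \<eta> = arc (3 - \<eta>)" by (simp add: patch_def arc_3 algebra_simps)
  have 3: "patch \<alpha> 0 = arc (- real p * \<alpha>)" by (simp add: patch_def algebra_simps)
  have 4: "patch \<alpha> 1 = arc (1 + \<alpha>)" by (simp add: patch_def algebra_simps)
  show "disc 0 \<eta> = arc \<eta>" "disc 1 \<eta> = arc (3 - \<eta>)" "disc \<alpha> 0 = arc (- real p * \<alpha>)" "disc \<alpha> 1 = arc (1 + \<alpha>)"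
    using disc_eq[of 0 \<eta>] disc_eq[of 1 \<eta>] disc_eq[of \<alpha> 0] disc_eq[of \<alpha> 1] unfolding 1 2 3 4 cmod_arc
    by auto
qed

lemma pF_left:
  assumes "x \<in> p_fractions" "0 \<le> \<eta>" "\<eta> \<le> 1"
  shows "pF (k, x) (disc 0 \<eta>) = pE (k, x) Gt \<eta>"
  using pF_arc[of "(k, x)" 0 \<eta>] assms by (simp add: verts_iff disc_boundary relator_def)

lemma pF_top:
  assumes "x \<in> p_fractions" "0 \<le> \<alpha>" "\<alpha> \<le> 1"
  shows "pF (k, x) (disc \<alpha> 1) = pE (k + 1, x) Ga \<alpha>"
  using pF_arc[of "(k, x)" 1 \<alpha>] assms by (simp add: verts_iff disc_boundary relator_def)

lemma pF_right:
  assumes "x \<in> p_fractions" "0 \<le> \<eta>" "\<eta> \<le> 1"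
  shows "pF (k, x) (disc 1 \<eta>) = pE (k, x + pw (k + 1)) Gt \<eta>"
proof -
  have "real 2 + (1 - \<eta>) = 3 - \<eta>" by simp
  then have "pF (k, x) (disc 1 \<eta>) = pE (k + 1, x + pw (k + 1)) Gt' (1 - \<eta>)"
    using pF_arc[of "(k, x)" 2 "1 - \<eta>"] assms
    by (simp add: verts_iff disc_boundary relator_def numeral_2_eq_2)
  also have "\<dots> = pE (k, x + pw (k + 1)) Gt \<eta>"
    using pE_inv[of "(k, x + pw (k + 1))" \<eta> Gt] p_fractions_shift[of x 1 "k + 1"] assms by (simp add: verts_iff)
  finally show ?thesis .
qed

lemma pF_bottom:
  assumes "x \<in> p_fractions" "j < p" "0 \<le> u" "u \<le> 1" "real p * \<alpha> = real j + u"
  shows "pF (k, x) (disc \<alpha> 0) = pE (k, x + real j * pw k) Ga u"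
proof -
  \<comment> \<open>The bottom is traversed last and from right to left, so its edge with index j
    from the left is this letter of the relator, read backwards.\<close>
  let ?i = "3 + (p - 1 - j)"
  have "real p + 3 - real p * \<alpha> = real ?i + (1 - u)" using assms by (simp add: of_nat_diff)
  moreover have "disc \<alpha> 0 = arc (real p + 3 - real p * \<alpha>)"
    using arc_periodic[of "real p * \<alpha>"] by (simp add: disc_boundary)
  ultimately have disc: "disc \<alpha> 0 = arc (real ?i + (1 - u))" by (simp only:)
  have "take ?i relator = [Gt, Ga, Gt'] @ replicate (p - 1 - j) Ga'"
    by (simp add: relator_def min_def numeral_3_eq_3)
  then have "act (k, x) (take ?i relator) = (k, x + pw (k + 1) - real (p - 1 - j) * pw k)"
    by (simp add: act_replicate)
  also have "x + pw (k + 1) - real (p - 1 - j) * pw k = x + real j * pw k + pw k"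
    unfolding pw_Suc using assms by (simp add: of_nat_diff algebra_simps)
  finally have act: "act (k, x) (take ?i relator) = (k, x + real j * pw k + pw k)" .
  have "relator ! ?i = Ga'" using assms by (simp add: relator_def nth_append)
  then have "pF (k, x) (disc \<alpha> 0) = pE (k, x + real j * pw k + pw k) Ga' (1 - u)"
    using pF_arc[of "(k, x)" ?i "1 - u"] assms act disc by (simp add: verts_iff)
  also have "\<dots> = pE (k, x + real j * pw k) Ga u"
    using pE_inv[of "(k, x + real j * pw k)" u Ga] p_fractions_shift[of x "int j" k] assms by (simp add: verts_iff)
  finally show ?thesis .
qed

section \<open>Tiling a plane by 2-cells\<close>

definition hor :: "int \<Rightarrow> real \<Rightarrow> real \<Rightarrow> (bsgen list set, bsgen) cell_pt set" where
  "hor k x b = (let n = \<lfloor>(b - x) / pw k\<rfloor> in pE (k, x + of_int n * pw k) Ga ((b - x) / pw k - of_int n))"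

lemma hor_eq:
  assumes "x \<in> p_fractions" "0 \<le> u" "u \<le> 1" "b = x + (of_int n + u) * pw k"
  shows "hor k x b = pE (k, x + of_int n * pw k) Ga u"
proof -
  have q: "(b - x) / pw k = of_int n + u" using assms by simp
  show ?thesis
  proof (cases "u = 1")
    case False
    then have "\<lfloor>of_int n + u\<rfloor> = n" using assms by linarith
    then show ?thesis using q by (simp add: hor_def)
  next
    case True
    have v: "(k, x + of_int n * pw k) \<in> verts" "(k, x + of_int (n + 1) * pw k) \<in> verts"
      using p_fractions_shift[OF assms(1)] by (auto simp only: verts_iff)
    have "hor k x b = pE (k, x + of_int (n + 1) * pw k) Ga 0"
      unfolding hor_def q using True by (simp add: add.commute)
    also have "\<dots> = pE (k, x + of_int n * pw k) Ga 1"
      using pE_0[OF v(2)] pE_1[OF v(1)] by (simp add: algebra_simps)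
    finally show ?thesis using True by simp
  qed
qed

text \<open>The lower left corner of tile m in row k. Its top is a single a-edge at height k + 1, so
  the tile has width p^(k + 1), whereas the bottom edges have length p^k.\<close>

definition corner :: "real \<Rightarrow> int \<times> int \<Rightarrow> int \<times> real" where
  "corner x = (\<lambda>(k, m). (k, x + of_int m * pw (k + 1)))"

definition rect :: "real \<Rightarrow> int \<times> int \<Rightarrow> real \<times> real \<Rightarrow> (bsgen list set, bsgen) cell_pt set" where
  "rect x = (\<lambda>(k, m) (y, b). pF (corner x (k, m)) (disc ((b - x) / pw (k + 1) - of_int m) (y - of_int k)))"

definition box :: "real \<Rightarrow> int \<times> int \<Rightarrow> (real \<times> real) set" where
  "box x = (\<lambda>(k, m). {of_int k .. of_int k + 1} \<times> {x + of_int m * pw (k + 1) .. x + (of_int m + 1) * pw (k + 1)})"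

lemma box_iff:
  "(y, b) \<in> box x (k, m) \<longleftrightarrow> of_int k \<le> y \<and> y \<le> of_int k + 1
     \<and> of_int m \<le> (b - x) / pw (k + 1) \<and> (b - x) / pw (k + 1) \<le> of_int m + 1"
  by (auto simp: box_def pos_le_divide_eq pos_divide_le_eq algebra_simps)

lemma corner_verts: "x \<in> p_fractions \<Longrightarrow> corner x i \<in> verts"
  by (cases i) (simp add: corner_def verts_iff p_fractions_shift)

lemma rect_bottom:
  assumes x: "x \<in> p_fractions" and b: "(of_int k, b) \<in> box x (k, m)"
  shows "rect x (k, m) (of_int k, b) = hor k x b"
proof -
  define \<alpha> where "\<alpha> = (b - x) / pw (k + 1) - of_int m"
  have \<alpha>: "0 \<le> \<alpha>" "\<alpha> \<le> 1" using b by (auto simp: box_iff \<alpha>_def)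
  have pa: "0 \<le> real p * \<alpha>" "real p * \<alpha> \<le> real p" using \<alpha> by (auto simp: mult_left_le)
  \<comment> \<open>The minimum matters only at \<alpha> = 1, where the floor is p: this point is
    the end u = 1 of the last bottom edge.\<close>
  define j where "j = min (p - 1) (nat \<lfloor>real p * \<alpha>\<rfloor>)"
  define u where "u = real p * \<alpha> - real j"
  have j: "j < p" using p_pos by (auto simp: j_def min_def)
  have f: "real (nat \<lfloor>real p * \<alpha>\<rfloor>) \<le> real p * \<alpha>" "real p * \<alpha> < real (nat \<lfloor>real p * \<alpha>\<rfloor>) + 1"
    using pa by linarith+
  have u: "0 \<le> u \<and> u \<le> 1"
  proof (cases "nat \<lfloor>real p * \<alpha>\<rfloor> \<le> p - 1")
    case True
    then have "j = nat \<lfloor>real p * \<alpha>\<rfloor>" by (simp add: j_def)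
    then show ?thesis using f unfolding u_def by (intro conjI; linarith)
  next
    case False
    then have "real p \<le> real (nat \<lfloor>real p * \<alpha>\<rfloor>)" "j = p - 1" by (auto simp: j_def)
    then have "real j = real p - 1" using p_ge_3 by (simp add: of_nat_diff)
    then show ?thesis using f pa \<open>real p \<le> _\<close> unfolding u_def by (intro conjI; linarith)
  qed
  have "rect x (k, m) (of_int k, b) = pF (k, x + of_int m * pw (k + 1)) (disc \<alpha> 0)"
    by (simp add: rect_def corner_def \<alpha>_def)
  also have "\<dots> = pE (k, x + of_int m * pw (k + 1) + real j * pw k) Ga u"
    by (rule pF_bottom) (use j u p_fractions_shift[OF x] in \<open>auto simp: u_def\<close>)
  also have "x + of_int m * pw (k + 1) + real j * pw k = x + of_int (m * int p + int j) * pw k"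
    unfolding pw_Suc by (simp add: algebra_simps)
  also have "pE (k, x + of_int (m * int p + int j) * pw k) Ga u = hor k x b"
  proof (rule hor_eq[symmetric])
    have "(of_int (m * int p + int j) + u) * pw k = (of_int m + \<alpha>) * pw (k + 1)"
      unfolding pw_Suc by (simp add: u_def algebra_simps)
    also have "\<dots> = b - x" by (simp add: \<alpha>_def)
    finally show "b = x + (of_int (m * int p + int j) + u) * pw k" by simp
  qed (use x u in auto)
  finally show ?thesis .
qed

lemma rect_top:
  assumes x: "x \<in> p_fractions" and b: "(of_int k + 1, b) \<in> box x (k, m)"
  shows "rect x (k, m) (of_int k + 1, b) = hor (k + 1) x b"
proof -
  define \<alpha> where "\<alpha> = (b - x) / pw (k + 1) - of_int m"
  have \<alpha>: "0 \<le> \<alpha>" "\<alpha> \<le> 1" using b by (auto simp: box_iff \<alpha>_def)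
  have "rect x (k, m) (of_int k + 1, b) = pE (k + 1, x + of_int m * pw (k + 1)) Ga \<alpha>"
    using pF_top[OF p_fractions_shift[OF x] \<alpha>] by (simp add: rect_def corner_def \<alpha>_def)
  also have "\<dots> = hor (k + 1) x b"
    by (rule hor_eq[symmetric]) (use x \<alpha> in \<open>auto simp: \<alpha>_def\<close>)
  finally show ?thesis .
qed

lemma rect_agree_aux:
  assumes x: "x \<in> p_fractions" and q: "(y, b) \<in> box x (k, m)" "(y, b) \<in> box x (k, m + 1)"
  shows "rect x (k, m) (y, b) = rect x (k, m + 1) (y, b)"
proof -
  have b: "(b - x) / pw (k + 1) = of_int m + 1" and y: "0 \<le> y - of_int k" "y - of_int k \<le> 1"
    using q by (auto simp: box_iff)
  have "rect x (k, m) (y, b) = pE (k, x + of_int m * pw (k + 1) + pw (k + 1)) Gt (y - of_int k)"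
    using pF_right[OF p_fractions_shift[OF x, of m "k + 1"] y, of k] b by (simp add: rect_def corner_def)
  also have "x + of_int m * pw (k + 1) + pw (k + 1) = x + of_int (m + 1) * pw (k + 1)"
    by (simp add: algebra_simps)
  also have "pE (k, x + of_int (m + 1) * pw (k + 1)) Gt (y - of_int k) = rect x (k, m + 1) (y, b)"
    using pF_left[OF p_fractions_shift[OF x, of "m + 1" "k + 1"] y, of k] b by (simp add: rect_def corner_def)
  finally show ?thesis .
qed

text \<open>Distinct tiles of one row meet only if adjacent, and then along a t-edge. Tiles of
  different rows meet on a horizontal line, where both maps equal \<open>hor\<close>, which depends
  on the height and the line but not on the tile.\<close>

lemma rect_agree:
  assumes x: "x \<in> p_fractions" and q: "q \<in> box x i" "q \<in> box x j"
  shows "rect x i q = rect x j q"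
proof -
  obtain y b k m k' m' where [simp]: "q = (y, b)" "i = (k, m)" "j = (k', m')"
    by (cases q, cases i, cases j) auto
  consider "k' = k" | "k' = k + 1" | "k = k' + 1"
    using q by (fastforce simp: box_iff)
  then show ?thesis
  proof cases
    case 1
    then consider "m' = m" | "m' = m + 1" | "m = m' + 1" using q by (fastforce simp: box_iff)
    then show ?thesis using 1 rect_agree_aux[OF x] q by cases auto
  next
    case 2
    then have "y = of_int k + 1" using q by (auto simp: box_iff)
    then show ?thesis using rect_top[OF x, of k b m] rect_bottom[OF x, of k' b m'] q 2 by simp
  next
    case 3
    then have "y = of_int k' + 1" using q by (auto simp: box_iff)
    then show ?thesis using rect_top[OF x, of k' b m'] rect_bottom[OF x, of k b m] q 3 by simp
  qed
qed

definition tile :: "real \<Rightarrow> real \<Rightarrow> real \<Rightarrow> int \<times> int" where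
  "tile x y b = (\<lfloor>y\<rfloor>, \<lfloor>(b - x) / pw (\<lfloor>y\<rfloor> + 1)\<rfloor>)"

text \<open>The Bass--Serre tree of the group has the cosets of \<open>\<langle>a\<rangle>\<close> as vertices; \<open>plane x\<close> parametrises
  the part of the complex over its bi-infinite line through the cosets of the vertices \<open>(k, x)\<close>.\<close>

definition plane :: "real \<Rightarrow> real \<Rightarrow> real \<Rightarrow> (bsgen list set, bsgen) cell_pt set" where
  "plane x y b = rect x (tile x y b) (y, b)"

lemma tile_box: "(y, b) \<in> box x (tile x y b)"
  unfolding tile_def box_iff by linarith

lemma plane_eq_rect: "x \<in> p_fractions \<Longrightarrow> (y, b) \<in> box x i \<Longrightarrow> plane x y b = rect x i (y, b)"
  unfolding plane_def by (rule rect_agree[OF _ tile_box])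

lemma plane_hor: "x \<in> p_fractions \<Longrightarrow> plane x (of_int k) b = hor k x b"
  using rect_bottom[of x k b "\<lfloor>(b - x) / pw (k + 1)\<rfloor>"] tile_box[of "of_int k" b x]
  by (simp add: plane_def tile_def)

lemma plane_Ga:
  assumes "x \<in> p_fractions" "0 \<le> s" "s \<le> 1"
  shows "plane x (of_int k) (x + s * pw k) = pE (k, x) Ga s"
  using hor_eq[OF assms, of "x + s * pw k" 0 k] plane_hor[OF assms(1)] by simp

lemma plane_Gt:
  assumes "x \<in> p_fractions" "0 \<le> s" "s \<le> 1"
  shows "plane x (of_int k + s) x = pE (k, x) Gt s"
proof -
  have "plane x (of_int k + s) x = rect x (k, 0) (of_int k + s, x)"
    by (rule plane_eq_rect) (use assms in \<open>auto simp: box_iff\<close>)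
  then show ?thesis using pF_left[OF assms] by (simp add: rect_def corner_def)
qed

lemma plane_vertex: "x \<in> p_fractions \<Longrightarrow> plane x (of_int k) x = pV (k, x)"
  using plane_Ga[of x 0 k] pE_0[of "(k, x)" Ga] by (simp add: verts_iff)

lemma plane_hor_X1:
  assumes "x \<in> p_fractions" shows "plane x (of_int k) b \<in> X1"
proof -
  have "0 \<le> r - of_int \<lfloor>r\<rfloor>" "r - of_int \<lfloor>r\<rfloor> \<le> 1" for r :: real by linarith+
  then show ?thesis
    unfolding plane_hor[OF assms] hor_def Let_def
    by (intro pE_in_X1) (simp_all only: verts_iff p_fractions_shift[OF assms])
qed

lemma plane_vert_X1:
  assumes "x \<in> p_fractions" shows "plane x y x \<in> X1"
proof -
  have "plane x (of_int \<lfloor>y\<rfloor> + frac y) x = pE (\<lfloor>y\<rfloor>, x) Gt (frac y)"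
    by (rule plane_Gt[OF assms]) (auto intro: less_imp_le frac_lt_1)
  then show ?thesis using pE_in_X1[of "(\<lfloor>y\<rfloor>, x)" "frac y" Gt] assms frac_lt_1[of y]
    by (simp add: verts_iff frac_def less_imp_le)
qed

lemma pw_multiple: "l \<le> k \<Longrightarrow> pw k = of_int (int p ^ nat (k - l)) * pw l"
proof -
  assume "l \<le> k"
  then have "pw k = pw (int (nat (k - l)) + l)" by simp
  also have "\<dots> = real p ^ nat (k - l) * pw l" by (subst power_int_add) (auto simp only: power_int_of_nat p_pos of_nat_eq_0_iff simp_thms)
  finally show ?thesis by simp
qed

text \<open>Below height k the tile width divides p^k, so the shift moves the grid of a row onto
  itself. At height k itself the tiles have width p^(k + 1) and the grids may differ, but the
  horizontal line is subdivided into edges of length p^k and is still the same.\<close>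

lemma plane_shift:
  assumes x: "x \<in> p_fractions" and y: "y \<le> of_int k"
  shows "plane (x + of_int n * pw k) y b = plane x y b"
proof (cases "y = of_int k")
  case True
  define a where "a = (b - x) / pw k"
  have 1: "(b - (x + of_int n * pw k)) / pw k = a - of_int n"
    by (simp add: a_def field_simps)
  have 2: "\<lfloor>a - of_int n\<rfloor> = \<lfloor>a\<rfloor> - n" by linarith
  have "hor k (x + of_int n * pw k) b = hor k x b"
    unfolding hor_def Let_def a_def[symmetric] 1 2 by (simp add: algebra_simps)
  then show ?thesis using True plane_hor[OF x] plane_hor[OF p_fractions_shift[OF x]] by simp
next
  case False
  let ?l = "\<lfloor>y\<rfloor> + 1"
  have "?l \<le> k" using False y by linarith
  then obtain N where N: "pw k = of_int N * pw ?l" using pw_multiple by blast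
  define a c where "a = (b - x) / pw ?l" and "c = pw ?l"
  have 1: "(b - (x + of_int n * (of_int N * c))) / c = a - of_int (n * N)"
    by (simp add: a_def c_def field_simps)
  have 2: "\<lfloor>a - of_int (n * N)\<rfloor> = \<lfloor>a\<rfloor> - n * N" by linarith
  have "x + of_int n * (of_int N * c) + of_int (\<lfloor>a\<rfloor> - n * N) * c = x + of_int \<lfloor>a\<rfloor> * c"
    by (simp add: algebra_simps)
  moreover have "a - of_int (n * N) - of_int (\<lfloor>a\<rfloor> - n * N) = a - of_int \<lfloor>a\<rfloor>" by simp
  ultimately show ?thesis
    unfolding plane_def rect_def tile_def corner_def prod.case N c_def[symmetric] 1 2
    by (simp only: a_def[folded c_def, symmetric])
qed

lemma continuous_map_rect:
  assumes x: "x \<in> p_fractions"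
  shows "continuous_map (top_of_set (box x i)) X (rect x i)"
proof -
  obtain k m where i: "i = (k, m)" by fastforce
  let ?d = "\<lambda>q. disc ((snd q - x) / pw (k + 1) - of_int m) (fst q - of_int k)"
  have "continuous_map (top_of_set (box x i)) (top_of_set (cball 0 1)) ?d"
    by (auto simp: cmod_disc intro!: continuous_on_disc continuous_intros)
  from continuous_map_compose[OF this continuous_map_pF[OF corner_verts[OF x, of i]]]
  show ?thesis by (simp add: o_def rect_def i case_prod_unfold)
qed

lemma finite_int_near: "0 < c \<Longrightarrow> finite {m::int. \<bar>of_int m * c - r\<bar> \<le> (s::real)}"
proof -
  assume c: "0 < c"
  have "m \<in> {\<lfloor>(r - s) / c\<rfloor>..\<lceil>(r + s) / c\<rceil>}" if "\<bar>of_int m * c - r\<bar> \<le> s" for m :: int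
  proof -
    have "(r - s) / c \<le> of_int m" "of_int m \<le> (r + s) / c"
      using that c by (auto simp: field_simps abs_le_iff)
    then show ?thesis by (simp add: floor_le_iff le_ceiling_iff)
  qed
  then have "{m::int. \<bar>of_int m * c - r\<bar> \<le> s} \<subseteq> {\<lfloor>(r - s) / c\<rfloor>..\<lceil>(r + s) / c\<rceil>}" by blast
  then show ?thesis by (rule finite_subset) simp
qed

text \<open>The closed tiles are locally finite: their widths tend to 0 downwards, but a bounded
  neighbourhood meets only finitely many rows.\<close>

lemma continuous_map_plane:
  assumes x: "x \<in> p_fractions"
  shows "continuous_map euclidean X (\<lambda>q. plane x (fst q) (snd q))"
proof (rule pasting_lemma_locally_finite[where I = UNIV and T = "box x" and f = "rect x"])
  fix q :: "real \<times> real"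
  obtain y b where q: "q = (y, b)" by fastforce
  let ?V = "ball y 1 \<times> ball b 1"
  \<comment> \<open>Left ends of the tiles of row k that may meet the neighbourhood: 1 is its
    horizontal radius and the other summand is the width of the tile.\<close>
  define M where "M k = {m::int. \<bar>of_int m * pw (k + 1) - (b - x)\<bar> \<le> 1 + pw (k + 1)}" for k
  have "{i. box x i \<inter> ?V \<noteq> {}} \<subseteq> (SIGMA k : {\<lfloor>y\<rfloor> - 3..\<lfloor>y\<rfloor> + 3}. M k)"
  proof
    fix i assume "i \<in> {i. box x i \<inter> ?V \<noteq> {}}"
    then obtain y' b' where "(y', b') \<in> box x i \<inter> ?V" by fastforce
    moreover obtain k m where i: "i = (k, m)" by fastforce
    ultimately have *: "(y', b') \<in> box x (k, m)" "\<bar>y - y'\<bar> < 1" "\<bar>b - b'\<bar> < 1"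
      by (auto simp: dist_real_def)
    have "k \<in> {\<lfloor>y\<rfloor> - 3..\<lfloor>y\<rfloor> + 3}"
      using * unfolding box_iff atLeastAtMost_iff by linarith
    moreover have "of_int m * pw (k + 1) \<le> b' - x" "b' - x \<le> of_int m * pw (k + 1) + pw (k + 1)"
      using *(1) by (auto simp: box_def algebra_simps)
    then have "m \<in> M k" using *(3) unfolding M_def by auto
    ultimately show "i \<in> (SIGMA k : {\<lfloor>y\<rfloor> - 3..\<lfloor>y\<rfloor> + 3}. M k)" using i by simp
  qed
  moreover have "finite (SIGMA k : {\<lfloor>y\<rfloor> - 3..\<lfloor>y\<rfloor> + 3}. M k)"
    unfolding M_def by (intro finite_SigmaI finite_int_near) auto
  ultimately have "finite {i \<in> UNIV. box x i \<inter> ?V \<noteq> {}}" using finite_subset by simp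
  then show "\<exists>V. openin euclidean V \<and> q \<in> V \<and> finite {i \<in> UNIV. box x i \<inter> V \<noteq> {}}"
    using q by (intro exI[of _ ?V]) (auto intro: open_Times)
next
  fix i :: "int \<times> int"
  show "closedin euclidean (box x i)"
    by (cases i) (auto simp: box_def intro: closed_Times)
  show "continuous_map (subtopology euclidean (box x i)) X (rect x i)"
    by (rule continuous_map_rect[OF x])
next
  fix q :: "real \<times> real"
  show "\<exists>j. j \<in> UNIV \<and> q \<in> box x j \<and> plane x (fst q) (snd q) = rect x j q"
    using tile_box[of "fst q" "snd q" x] by (intro exI[of _ "tile x (fst q) (snd q)"]) (simp add: plane_def)
qed (use rect_agree[OF x] in auto)

section \<open>The combing\<close>

text \<open>The lines of the Bass--Serre tree given by \<open>0\<close> and by \<open>x\<close> agree exactly up to height \<open>- depth x\<close>.\<close>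

definition depth :: "real \<Rightarrow> nat" where
  "depth x = (LEAST K. x * real p ^ K \<in> \<int>)"

lemma depth_le_iff:
  assumes "x \<in> p_fractions" shows "depth x \<le> K \<longleftrightarrow> x * real p ^ K \<in> \<int>"
proof
  have depth: "x * real p ^ depth x \<in> \<int>"
    unfolding depth_def by (rule LeastI_ex) (use assms in \<open>simp add: p_fractions_def\<close>)
  assume "depth x \<le> K"
  then have "x * real p ^ K = (x * real p ^ depth x) * of_int (int p ^ (K - depth x))"
    by (simp flip: power_add)
  also have "\<dots> \<in> \<int>" using depth by (rule Ints_mult) simp
  finally show "x * real p ^ K \<in> \<int>" .
qed (simp add: depth_def Least_le)

text \<open>Multiplication by p^K with -K \<le> k makes the shift an integer, so it cannot affect
  integrality for such K. Seen from heights up to k, both lines leave the line of 0 at the same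
  place.\<close>

lemma depth_shift:
  assumes x: "x \<in> p_fractions"
  shows "min (- int (depth (x + of_int n * pw k))) k = min (- int (depth x)) k"
proof -
  have "depth (x + of_int n * pw k) \<le> K \<longleftrightarrow> depth x \<le> K" if "- int K \<le> k" for K
  proof -
    have "of_int n * pw k * real p ^ K \<in> \<int>"
      using Ints_mult[OF Ints_of_int pw_scaled_Ints[OF that], of n] by (simp add: mult.assoc)
    then have "(x + of_int n * pw k) * real p ^ K \<in> \<int> \<longleftrightarrow> x * real p ^ K \<in> \<int>"
      using Ints_add[of "x * real p ^ K"] Ints_diff[of "(x + of_int n * pw k) * real p ^ K"]
      by (fastforce simp: algebra_simps)
    then show ?thesis using depth_le_iff[OF x] depth_le_iff[OF p_fractions_shift[OF x, of n k]] by simp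
  qed
  from this[of "max (depth x) (nat (- k))"] this[of "max (depth (x + of_int n * pw k)) (nat (- k))"]
  show ?thesis by (simp add: le_max_iff_disj) linarith
qed

text \<open>The lowest height of the tree geodesic from the identity coset to height y on the line
  of x: the branching height, or y itself if that point still lies on the line of 0.\<close>

definition merge :: "real \<Rightarrow> real \<Rightarrow> real" where
  "merge x y = min (- real (depth x)) y"

definition clamp :: "real \<Rightarrow> real" where
  "clamp r = max 0 (min 1 r)"

lemma clamp_bounds: "0 \<le> clamp r" "clamp r \<le> 1" by (auto simp: clamp_def)

lemma clamp_mono: "r \<le> r' \<Longrightarrow> clamp r \<le> clamp r'" by (auto simp: clamp_def)

definition height :: "real \<Rightarrow> real \<Rightarrow> real \<Rightarrow> real" where
  "height x y s = merge x y + clamp (3 * s - 2) * (y - merge x y)"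

text \<open>Each phase takes a third of the time; the clamps let one formula cover the last two. The
  change of plane at time 1/3 happens at the merge height, where both planes agree by
  \<open>plane_0\<close>.\<close>

definition path :: "real \<Rightarrow> real \<Rightarrow> real \<Rightarrow> real \<Rightarrow> (bsgen list set, bsgen) cell_pt set" where
  "path x y b s = (if s \<le> 1/3 then plane 0 (3 * s * merge x y) 0
     else plane x (height x y s) (clamp (3 * s - 1) * b))"

lemma merge_le: "merge x y \<le> y" "merge x y \<le> 0"
  by (auto simp: merge_def)

lemma height_bounds: "merge x y \<le> height x y s" "height x y s \<le> y"
proof -
  have "clamp (3 * s - 2) * (y - merge x y) \<le> 1 * (y - merge x y)"
    using clamp_bounds merge_le by (intro mult_right_mono) auto
  then show "height x y s \<le> y" by (simp add: height_def)
  show "merge x y \<le> height x y s"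
    using clamp_bounds merge_le by (simp add: height_def)
qed

lemma plane_0:
  assumes x: "x \<in> p_fractions" and y: "y \<le> - real (depth x)"
  shows "plane x y b = plane 0 y b"
proof -
  have "x * real p ^ depth x \<in> \<int>" using depth_le_iff[OF x] by blast
  then obtain n where n: "x * real p ^ depth x = of_int n" by (auto elim: Ints_cases)
  have "x = 0 + of_int n * pw (- int (depth x))"
    by (simp add: power_int_minus n[symmetric])
  with plane_shift[OF p_fractions_0, of y "- int (depth x)" n b] y show ?thesis by simp
qed

lemma path_0: "path x y b 0 = pV (0, 0)"
  using plane_vertex[OF p_fractions_0, of 0] by (simp add: path_def)

lemma path_1: "path x y b 1 = plane x y b"
  by (simp add: path_def height_def clamp_def)

text \<open>A vertex is the end of a-edges whose paths are taken in the planes of different initial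
  vertices. This lemma makes these paths coincide: they share the merge height, and they never rise
  above k.\<close>

lemma path_shift:
  assumes x: "x \<in> p_fractions" and y: "y \<le> of_int k"
  shows "path (x + of_int n * pw k) y b s = path x y b s"
proof -
  let ?x = "x + of_int n * pw k"
  have "min (- real (depth ?x)) (of_int k) = of_int (min (- int (depth ?x)) k)" by simp
  also have "\<dots> = min (- real (depth x)) (of_int k)" unfolding depth_shift[OF x] by simp
  finally have merge: "merge ?x y = merge x y" using y by (auto simp: merge_def min_def split: if_splits)
  then have "height ?x y s = height x y s" by (simp add: height_def)
  moreover have "height x y s \<le> of_int k" using height_bounds(2)[of x y s] y by simp
  ultimately show ?thesis
    using plane_shift[OF x, of "height x y s" k n] merge by (simp add: path_def)
qed

lemma continuous_map_path:
  assumes x: "x \<in> p_fractions" and fg: "continuous_on S f" "continuous_on S g" "continuous_on S h"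
  shows "continuous_map (top_of_set S) X (\<lambda>q. path x (f q) (g q) (h q))"
proof -
  have cont: "continuous_map (top_of_set T) X (\<lambda>q. plane z (u q) (v q))"
    if "z \<in> p_fractions" "continuous_on T u" "continuous_on T v" for z T and u v :: "'a \<Rightarrow> real"
  proof -
    have "continuous_map (top_of_set T) euclidean (\<lambda>q. (u q, v q))"
      using that by (simp add: continuous_on_Pair)
    from continuous_map_compose[OF this continuous_map_plane[OF that(1)]] show ?thesis
      by (simp add: o_def)
  qed
  have merge: "continuous_on T (\<lambda>q. merge x (f q))" if "T \<subseteq> S" for T
    unfolding merge_def using continuous_on_subset[OF fg(1) that] by (intro continuous_intros)
  have height: "continuous_on T (\<lambda>q. height x (f q) (h q))" if "T \<subseteq> S" for T
    unfolding height_def clamp_def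
    by (intro continuous_intros merge that continuous_on_subset[OF fg(1) that] continuous_on_subset[OF fg(3) that])
  show ?thesis
    unfolding path_def
  proof (rule continuous_map_cases_le)
    show "continuous_map (top_of_set S) euclideanreal h" using fg by simp
    let ?T = "{q \<in> topspace (top_of_set S). h q \<le> 1/3}"
    have T: "?T \<subseteq> S" by auto
    have "continuous_map (top_of_set ?T) X (\<lambda>q. plane 0 (3 * h q * merge x (f q)) 0)"
      by (rule cont[OF p_fractions_0]) (intro continuous_intros merge T continuous_on_subset[OF fg(3) T])+
    then show "continuous_map (subtopology (top_of_set S) ?T) X (\<lambda>q. plane 0 (3 * h q * merge x (f q)) 0)"
      using T by (simp add: subtopology_subtopology Int_absorb1)
    let ?T = "{q \<in> topspace (top_of_set S). 1/3 \<le> h q}"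
    have T: "?T \<subseteq> S" by auto
    have "continuous_map (top_of_set ?T) X (\<lambda>q. plane x (height x (f q) (h q)) (clamp (3 * h q - 1) * g q))"
    proof (rule cont[OF x])
      show "continuous_on ?T (\<lambda>q. height x (f q) (h q))" by (rule height[OF T])
      show "continuous_on ?T (\<lambda>q. clamp (3 * h q - 1) * g q)"
        unfolding clamp_def by (intro continuous_intros continuous_on_subset[OF fg(3) T] continuous_on_subset[OF fg(2) T])
    qed
    then show "continuous_map (subtopology (top_of_set S) ?T) X (\<lambda>q. plane x (height x (f q) (h q)) (clamp (3 * h q - 1) * g q))"
      using T by (simp add: subtopology_subtopology Int_absorb1)
  next
    fix q assume "h q = 1/3"
    then have "3 * h q * merge x (f q) = merge x (f q)" "3 * h q - 2 = - 1" "3 * h q - 1 = 0" by auto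
    then show "plane 0 (3 * h q * merge x (f q)) 0 = plane x (height x (f q) (h q)) (clamp (3 * h q - 1) * g q)"
      using plane_0[OF x, of "merge x (f q)" 0] by (simp only: height_def) (simp add: clamp_def merge_def)
  qed simp
qed

text \<open>For a vertex the turning height is an integer, so the horizontal phase follows a-edges.
  The ascent has coordinate x throughout and follows t-edges, as does the first descent at
  coordinate 0.\<close>

lemma path_X1:
  assumes x: "x \<in> p_fractions" shows "path x (of_int k) x s \<in> X1"
proof -
  have merge: "merge x (of_int k) = of_int (min (- int (depth x)) k)" by (simp add: merge_def)
  show ?thesis
  proof (cases "s \<le> 1/3")
    case True
    then show ?thesis using plane_vert_X1[OF p_fractions_0] by (simp add: path_def)
  next
    case False
    show ?thesis
    proof (cases "s \<le> 2/3")
      case True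
      then have "height x (of_int k) s = of_int (min (- int (depth x)) k)"
        using merge by (simp add: height_def clamp_def)
      then show ?thesis using False plane_hor_X1[OF x] by (simp only: path_def if_False)
    next
      case False
      then have "clamp (3 * s - 1) = 1" by (simp add: clamp_def)
      then show ?thesis using False plane_vert_X1[OF x] by (simp add: path_def)
    qed
  qed
qed

section \<open>Transfer of the paths to gluing classes\<close>

fun rep_path :: "(bsgen list set, bsgen) cell_pt \<Rightarrow> real \<Rightarrow> (bsgen list set, bsgen) cell_pt set" where
  "rep_path (RV g) t = (case inv_into verts el g of (k, x) \<Rightarrow> path x (of_int k) x t)"
| "rep_path (RE g y s) t = (case inv_into verts el g of (k, x) \<Rightarrow>
     if y = Ga then path x (of_int k) (x + s * pw k) t else path x (of_int k + s) x t)"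
| "rep_path (RF g i z) t = undefined"

text \<open>The arbitrary choice is harmless because \<open>nf\<close> is constant on gluing
  classes.\<close>

definition combing :: "(bsgen list set, bsgen) cell_pt set \<Rightarrow> real \<Rightarrow> (bsgen list set, bsgen) cell_pt set" where
  "combing P t = rep_path (nf (SOME Q. Q \<in> P)) t"

lemma inv_el: "v \<in> verts \<Longrightarrow> inv_into verts el (el v) = v"
  by (rule inv_into_f_f) (auto intro: inj_onI el_inj)

lemma combing_cls: "combing (cc_cls bs_inv rels Q) t = rep_path (nf Q) t"
proof -
  have "(SOME T. T \<in> cc_cls bs_inv rels Q) \<in> cc_cls bs_inv rels Q"
    by (rule someI[of _ Q]) (simp add: cc_cls_mem cc_eq_refl)
  then have "nf (SOME T. T \<in> cc_cls bs_inv rels Q) = nf Q"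
    using nf_eq unfolding cc_cls_mem by metis
  then show ?thesis by (simp add: combing_def)
qed

lemma combing_Ga:
  assumes x: "x \<in> p_fractions" and s: "0 \<le> s" "s \<le> 1"
  shows "combing (pE (k, x) Ga s) t = path x (of_int k) (x + s * pw k) t"
proof -
  have v: "(k, x) \<in> verts" "(k, x + pw k) \<in> verts"
    using x p_fractions_shift[OF x, of 1 k] by (auto simp: verts_iff)
  have "combing (pE (k, x) Ga s) t = rep_path (nfE (el (k, x)) Ga s) t"
    by (simp add: pE_def combing_cls)
  \<comment> \<open>At s = 1 the representative is the vertex (k, x + p^k), whose path is taken in
    its own plane; \<open>path_shift\<close> brings it back to the plane of x.\<close>
  also have "\<dots> = path x (of_int k) (x + s * pw k) t"
    using path_shift[OF x, of "of_int k" k 1] v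
    by (auto simp: nfE_def grp_mult_el inv_el)
  finally show ?thesis .
qed

lemma combing_Gt:
  assumes x: "x \<in> p_fractions" and s: "0 \<le> s" "s \<le> 1"
  shows "combing (pE (k, x) Gt s) t = path x (of_int k + s) x t"
proof -
  have v: "(k, x) \<in> verts" "(k + 1, x) \<in> verts" using x by (auto simp: verts_iff)
  have "combing (pE (k, x) Gt s) t = rep_path (nfE (el (k, x)) Gt s) t"
    by (simp add: pE_def combing_cls)
  also have "\<dots> = path x (of_int k + s) x t"
    using v by (auto simp: nfE_def grp_mult_el inv_el)
  finally show ?thesis .
qed

lemma X1_path:
  assumes "P \<in> X1"
  obtains x y b where "x \<in> p_fractions" "P = plane x y b" "\<And>t. combing P t = path x y b t"
proof -
  obtain v g s where P: "v \<in> verts" "0 \<le> s" "s \<le> 1" "P = pE v g s"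
    using assms unfolding cc_X1_eq by blast
  obtain v g s where P: "v \<in> verts" "0 \<le> s" "s \<le> 1" "P = pE v g s" and g: "g = Ga \<or> g = Gt"
  proof (cases "g = Ga \<or> g = Gt")
    case False
    then have "bs_inv g = Ga \<or> bs_inv g = Gt" by (cases g) auto
    then show ?thesis
      using that[of "step g v" "1 - s" "bs_inv g"] P step_verts pE_inv[of v s g] by simp
  qed (use P that in blast)
  obtain k x where v: "v = (k, x)" "x \<in> p_fractions" using P(1) by (cases v) (auto simp: verts_iff)
  from g show ?thesis
  proof
    assume "g = Ga"
    then show ?thesis
      using that[OF v(2), of "of_int k" "x + s * pw k"] plane_Ga[OF v(2) P(2,3)] combing_Ga[OF v(2) P(2,3)] P v
      by simp
  next
    assume "g = Gt"
    then show ?thesis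
      using that[OF v(2), of "of_int k + s" x] plane_Gt[OF v(2) P(2,3)] combing_Gt[OF v(2) P(2,3)] P v
      by simp
  qed
qed

lemma is_1combing_combing: "is_1combing bs_inv rels combing"
  unfolding is_1combing_def
proof (intro conjI ballI)
  let ?I = "{0..1::real}"
  have pos: "continuous_map (prod_topology (top_of_set ?I) (top_of_set ?I)) X (\<lambda>(s, t). combing (pE v g s) t)"
    if v: "v \<in> verts" and g: "g = Ga \<or> g = Gt" for v g
  proof -
    obtain k x where v: "v = (k, x)" "x \<in> p_fractions" using v by (cases v) (auto simp: verts_iff)
    have "continuous_map (top_of_set (?I \<times> ?I)) X (\<lambda>q. path x (of_int k) (x + fst q * pw k) (snd q))"
      "continuous_map (top_of_set (?I \<times> ?I)) X (\<lambda>q. path x (of_int k + fst q) x (snd q))"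
      by (intro continuous_map_path[OF v(2)] continuous_intros)+
    note cont = this[unfolded prod_topology_subtopology_eu[symmetric]]
    from g show ?thesis
    proof
      assume "g = Ga"
      then show ?thesis
        by (intro continuous_map_eq[OF cont(1)]) (auto simp: v(1) combing_Ga[OF v(2)])
    next
      assume "g = Gt"
      then show ?thesis
        by (intro continuous_map_eq[OF cont(2)]) (auto simp: v(1) combing_Gt[OF v(2)])
    qed
  qed
  show "continuous_map (prod_topology (subtopology X X1) (top_of_set ?I)) X (\<lambda>(P, s). combing P s)"
  proof (rule continuous_map_X1_times_I)
    fix v g assume v: "v \<in> verts"
    show "continuous_map (prod_topology (top_of_set ?I) (top_of_set ?I)) X (\<lambda>(s, t). combing (pE v g s) t)"
    proof (cases "g = Ga \<or> g = Gt")
      case False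
      then have g: "bs_inv g = Ga \<or> bs_inv g = Gt" by (cases g) auto
      have "continuous_map (prod_topology (top_of_set ?I) (top_of_set ?I)) (prod_topology (top_of_set ?I) (top_of_set ?I))
        (\<lambda>q. (1 - fst q, snd q))"
        by (auto simp: prod_topology_subtopology_eu intro!: continuous_intros)
      from continuous_map_compose[OF this pos[OF step_verts[OF v] g, of g]] show ?thesis
        by (rule continuous_map_eq) (auto simp: pE_inv[OF v])
    qed (use pos v in blast)
  qed
next
  fix P assume "P \<in> X1"
  from X1_path[OF this] obtain x y b
    where *: "x \<in> p_fractions" "P = plane x y b" "\<And>t. combing P t = path x y b t" by metis
  show "combing P 0 = cc_base bs_inv rels"
    by (simp add: *(3) path_0 cc_base_def pV_def grp_id_eq)
  show "combing P 1 = P" using *(2) *(3)[of 1] path_1[of x y b] by simp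
next
  fix P s assume "P \<in> cc_X0 bs_inv rels"
  then obtain k x where v: "x \<in> p_fractions" "P = pV (k, x)"
    unfolding cc_X0_eq by (auto simp: verts_iff)
  then have "combing P s = path x (of_int k) x s"
    by (simp add: pV_def combing_cls inv_el verts_iff)
  then show "combing P s \<in> X1" using path_X1[OF v(1)] by simp
qed

section \<open>Tameness\<close>

text \<open>The lower left corner of its tile stands in for a point: horizontally it is off by at
  most a tile width, and its length differs from the level by a bounded amount.\<close>

lemma plane_corner:
  assumes x: "x \<in> p_fractions"
  obtains x' where "(\<lfloor>y\<rfloor>, x') \<in> verts" "\<bar>x' - b\<bar> \<le> pw (\<lfloor>y\<rfloor> + 1)" "\<exists>m. x' = x + of_int m * pw (\<lfloor>y\<rfloor> + 1)"
    "real (len (\<lfloor>y\<rfloor>, x')) - (real p + 3) \<le> lev (plane x y b)"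
    "lev (plane x y b) \<le> real (len (\<lfloor>y\<rfloor>, x')) + real p + 4" "0 \<le> lev (plane x y b)"
proof -
  define m where "m = \<lfloor>(b - x) / pw (\<lfloor>y\<rfloor> + 1)\<rfloor>"
  define x' where "x' = x + of_int m * pw (\<lfloor>y\<rfloor> + 1)"
  have tile: "tile x y b = (\<lfloor>y\<rfloor>, m)" by (simp add: tile_def m_def)
  have v: "(\<lfloor>y\<rfloor>, x') \<in> verts" by (simp add: x'_def verts_iff p_fractions_shift[OF x])
  have "(y, b) \<in> box x (\<lfloor>y\<rfloor>, m)" using tile_box[of y b x] tile by simp
  then have near: "\<bar>x' - b\<bar> \<le> pw (\<lfloor>y\<rfloor> + 1)" by (auto simp: box_def x'_def algebra_simps)
  have "plane x y b = pF (\<lfloor>y\<rfloor>, x') (disc ((b - x) / pw (\<lfloor>y\<rfloor> + 1) - of_int m) (y - of_int \<lfloor>y\<rfloor>))"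
    unfolding plane_def tile by (simp add: rect_def corner_def x'_def)
  then show ?thesis
    using that[OF v near] lev_pF_bounds[OF v cmod_disc] x'_def by auto
qed

lemma corner_Ints:
  assumes x: "x * real p ^ K \<in> \<int>" and x': "x' = x + of_int m * pw (k + 1)" and k: "- int K \<le> k + 1"
  shows "x' * real p ^ K \<in> \<int>"
proof -
  have "of_int m * (pw (k + 1) * real p ^ K) \<in> \<int>"
    by (rule Ints_mult[OF Ints_of_int pw_scaled_Ints[OF k]])
  from Ints_add[OF x this] show ?thesis by (simp add: x' algebra_simps)
qed

text \<open>The primed vertex is the later one. The number \<open>e\<close> is a depth to which
  every word for it must descend, since the premise covers every possible count L of its letters
  t^-1. With n its length, the earlier vertex is written with n + 2 digits at depth e, and 2 e + k
  \<le> 2 n; \<open>len_upper\<close> then yields the two constants.\<close>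

lemma len_comparison:
  fixes e :: nat
  assumes vt: "(k', x') \<in> verts" and e: "\<And>L. - int L \<le> k' \<Longrightarrow> x' * real p ^ L \<in> \<int> \<Longrightarrow> e \<le> L"
    and int: "x * real p ^ e \<in> \<int>" and k: "- int e \<le> k" "k \<le> max 0 k'"
    and b: "\<bar>x - b\<bar> \<le> pw (k + 1)" "\<bar>b\<bar> \<le> \<bar>b'\<bar>" "\<bar>x' - b'\<bar> \<le> pw (k' + 1)"
  shows "real (len (k, x)) \<le> (real (p div 2) + 4) * real (len (k', x')) + (2 * real (p div 2) + 5)"
proof -
  define n where "n = len (k', x')"
  obtain N H L :: nat where nhl: "\<bar>x'\<bar> \<le> real N * real p ^ H" "x' * real p ^ L \<in> \<int>" "- int L \<le> k'"
    "k' \<le> int H" "N + H + L \<le> n"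
    using len_lower[OF vt] unfolding n_def fst_conv snd_conv by blast
  have eL: "e \<le> L" using e nhl by blast
  have kH: "k \<le> int H" using k nhl by linarith
  have p1: "1 \<le> real p" using p_ge_3 by simp
  have pwH: "pw (l + 1) \<le> real p ^ (H + 1)" if "l \<le> int H" for l
    using power_int_increasing[of "l + 1" "int (H + 1)" "real p"] that p1
    unfolding power_int_of_nat by simp
  obtain m where m: "x * real p ^ e = of_int m" using int by (auto elim: Ints_cases)
  then have x: "x = of_int m * pw (- int e)" by (simp add: power_int_minus field_simps)
  \<comment> \<open>The last two terms are the distances of the vertices from their points, at most
    p^(H + 1) each. They are absorbed into two extra digits.\<close>
  have "\<bar>x\<bar> \<le> \<bar>x'\<bar> + pw (k' + 1) + pw (k + 1)" using b by linarith
  also have "\<dots> \<le> real N * real p ^ H + real p ^ (H + 1) + real p ^ (H + 1)"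
    using nhl(1) pwH[OF nhl(4)] pwH[OF kH] by linarith
  also have "\<dots> = (real N + 2 * real p) * real p ^ H" by (simp add: algebra_simps)
  also have "\<dots> \<le> real p ^ (N + 2) * real p ^ H"
  proof (intro mult_right_mono)
    have "real N + 2 * real p \<le> real p ^ (N + 2)"
    proof (induction N)
      case 0
      then show ?case using p_ge_3 by (simp add: power2_eq_square)
    next
      case (Suc N)
      have "1 \<le> real p ^ (N + 2)" using p1 by (rule one_le_power)
      then have "real (Suc N) + 2 * real p \<le> 2 * real p ^ (N + 2)" using Suc by simp
      also have "\<dots> \<le> real p * real p ^ (N + 2)" using p_ge_3 by (intro mult_right_mono) auto
      finally show ?case by simp
    qed
    then show "real N + 2 * real p \<le> real p ^ (N + 2)" .
  qed simp
  finally have "\<bar>x\<bar> * real p ^ e \<le> real p ^ (N + 2) * real p ^ H * real p ^ e"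
    by (rule mult_right_mono) simp
  also have "\<dots> = real p ^ (N + 2 + H + e)" by (simp add: power_add)
  also have "\<dots> \<le> real p ^ (n + 2)" using nhl(5) eL p1 by (intro power_increasing) auto
  finally have "\<bar>of_int m\<bar> \<le> real p ^ (n + 2)" using m by (simp add: abs_mult flip: m)
  then have "real_of_int \<bar>m\<bar> \<le> of_int (int p ^ (n + 2))" by simp
  then have "\<bar>m\<bar> \<le> int p ^ (n + 2)" unfolding of_int_le_iff .
  from len_upper[OF this k(1)]
  have "int (len (k, x)) \<le> 2 * int e + (int (p div 2) + 2) * int (n + 2) + 1 + k"
    unfolding x .
  also have "\<dots> \<le> 2 * int n + (int (p div 2) + 2) * int (n + 2) + 1"
    using eL kH nhl(5) by simp
  finally have "real_of_int (int (len (k, x))) \<le> of_int (2 * int n + (int (p div 2) + 2) * int (n + 2) + 1)"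
    unfolding of_int_le_iff .
  then show ?thesis by (simp add: n_def algebra_simps)
qed

text \<open>Both points are replaced by the corners of their tiles and \<open>len_comparison\<close>
  is applied. The exchange costs p + 4 at the earlier point and p + 3, multiplied by the slope, at
  the later one.\<close>

lemma lev_path:
  assumes x: "x \<in> p_fractions" and st: "0 \<le> s" "s < t" "t \<le> 1"
  shows "lev (path x y b s) \<le> (real (p div 2) + 4) * (lev (path x y b t) + real p + 3) + 2 * real (p div 2) + real p + 9"
    and "0 \<le> lev (path x y b t)"
proof -
  define X' where "X' s = (if s \<le> 1/3 then 0 else x)" for s :: real
  define Y where "Y s = (if s \<le> 1/3 then 3 * s * merge x y else height x y s)" for s
  define B where "B s = (if s \<le> 1/3 then 0 else clamp (3 * s - 1) * b)" for s
  \<comment> \<open>The lowest height met up to time s. It controls the denominators of the current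
    corner, also after the path has started to rise.\<close>
  define E where "E s = (if s \<le> 1/3 then 3 * s * merge x y else merge x y)" for s
  have path: "path x y b s = plane (X' s) (Y s) (B s)" for s
    by (simp add: path_def X'_def Y_def B_def)
  have X_fractions: "X' s \<in> p_fractions" for s using x by (simp add: X'_def)
  have E0: "E s \<le> 0" if "0 \<le> s" for s
    using merge_le(2)[of x y] that by (auto simp: E_def intro: mult_nonneg_nonpos)
  have EY: "E s \<le> Y s" for s using height_bounds(1) by (simp add: E_def Y_def)
  have 3: "merge x y \<le> 3 * s * merge x y" if "s \<le> 1/3" for s
    using mult_right_mono_neg[OF _ merge_le(2)[of x y], of "3 * s" 1] that by simp
  have Emono: "E t \<le> E s"
    using st 3[of s] 3[of t] mult_right_mono_neg[OF _ merge_le(2)[of x y], of "3 * s" "3 * t"]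
    by (auto simp: E_def)
  have Bmono: "\<bar>B s\<bar> \<le> \<bar>B t\<bar>"
    using st clamp_mono[of "3 * s - 1" "3 * t - 1"] clamp_bounds
    by (auto simp: B_def abs_mult intro!: mult_right_mono)
  have Ymono: "Y s \<le> max 0 (Y t)"
  proof (cases "s \<le> 1/3")
    case True
    then show ?thesis using E0[of s] st by (simp add: Y_def E_def)
  next
    case False
    then have "Y s \<le> Y t"
      using st clamp_mono[of "3 * s - 2" "3 * t - 2"] merge_le(1)[of x y]
      by (auto simp: Y_def height_def intro!: mult_right_mono)
    then show ?thesis by simp
  qed
  have Kmono: "\<lfloor>Y s\<rfloor> \<le> max 0 \<lfloor>Y t\<rfloor>" using Ymono by linarith
  obtain xs where vs: "(\<lfloor>Y s\<rfloor>, xs) \<in> verts" "\<bar>xs - B s\<bar> \<le> pw (\<lfloor>Y s\<rfloor> + 1)"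
    "\<exists>m. xs = X' s + of_int m * pw (\<lfloor>Y s\<rfloor> + 1)" "lev (path x y b s) \<le> real (len (\<lfloor>Y s\<rfloor>, xs)) + real p + 4"
    using plane_corner[OF X_fractions] path by metis
  obtain xt where vt: "(\<lfloor>Y t\<rfloor>, xt) \<in> verts" "\<bar>xt - B t\<bar> \<le> pw (\<lfloor>Y t\<rfloor> + 1)"
    "\<exists>m. xt = X' t + of_int m * pw (\<lfloor>Y t\<rfloor> + 1)" "real (len (\<lfloor>Y t\<rfloor>, xt)) - (real p + 3) \<le> lev (path x y b t)"
    "0 \<le> lev (path x y b t)"
    using plane_corner[OF X_fractions] path by metis
  define e where "e = nat (- \<lfloor>E s\<rfloor>)"
  have e_eq: "int e = - \<lfloor>E s\<rfloor>" using E0[OF st(1)] by (simp add: e_def)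
  have depth_X: "X' s * real p ^ e \<in> \<int>"
  proof (cases "s \<le> 1/3")
    case False
    then have "E s \<le> - real (depth x)" by (simp add: E_def merge_def)
    then have "of_int \<lfloor>E s\<rfloor> \<le> - real (depth x)" by linarith
    then have "depth x \<le> e" using e_eq by linarith
    then show ?thesis using depth_le_iff[OF x] by (simp add: X'_def)
  qed (simp add: X'_def)
  have eL: "e \<le> L" if L: "- int L \<le> \<lfloor>Y t\<rfloor>" "xt * real p ^ L \<in> \<int>" for L
  proof -
    have "- \<lfloor>E t\<rfloor> \<le> int L"
    proof (cases "E t = Y t")
      case True
      then show ?thesis using L by simp
    next
      case False
      \<comment> \<open>The path has begun to rise, so the merge height is the branching height. The
        corner differs from x by a multiple of p^(\<lfloor>Y t\<rfloor> + 1), which p^L clears;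
        hence p^L clears the denominator of x as well, and L is at least the depth of x.\<close>
      then have t: "\<not> t \<le> 1/3" by (auto simp: E_def Y_def)
      with False have "merge x y \<noteq> y" by (auto simp: E_def Y_def height_def)
      then have "merge x y = - real (depth x)" by (auto simp: merge_def)
      then have "E t = of_int (- int (depth x))" using t by (simp add: E_def)
      then have Et: "\<lfloor>E t\<rfloor> = - int (depth x)" by (simp only: floor_of_int)
      show ?thesis
      proof (rule ccontr)
        assume "\<not> - \<lfloor>E t\<rfloor> \<le> int L"
        then have less: "L < depth x" using Et by simp
        obtain m where m: "xt = x + of_int m * pw (\<lfloor>Y t\<rfloor> + 1)" using vt(3) t by (auto simp: X'_def)
        have "x * real p ^ L \<in> \<int>"
          by (rule corner_Ints[OF L(2), of x "- m"]) (use m L in auto)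
        then show False using less depth_le_iff[OF x, of L] by simp
      qed
    qed
    then show ?thesis using e_eq floor_mono[OF Emono] by linarith
  qed
  have ks: "- int e \<le> \<lfloor>Y s\<rfloor>" using e_eq floor_mono[OF EY[of s]] by simp
  have int: "xs * real p ^ e \<in> \<int>"
    using vs(3) corner_Ints[OF depth_X] ks by force
  have "real (len (\<lfloor>Y s\<rfloor>, xs)) \<le> (real (p div 2) + 4) * real (len (\<lfloor>Y t\<rfloor>, xt)) + (2 * real (p div 2) + 5)"
    by (rule len_comparison[OF vt(1) eL int ks Kmono vs(2) Bmono vt(2)])
  also have "\<dots> \<le> (real (p div 2) + 4) * (lev (path x y b t) + real p + 3) + (2 * real (p div 2) + 5)"
    using vt(4) by (intro add_right_mono mult_left_mono) auto
  finally show "lev (path x y b s) \<le> (real (p div 2) + 4) * (lev (path x y b t) + real p + 3) + 2 * real (p div 2) + real p + 9"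
    using vs(4) by simp
  show "0 \<le> lev (path x y b t)" by (rule vt(5))
qed

lemma radial_tameness_combing:
  "radial_tameness bs_inv rels combing
     (\<lambda>q. 4 * (real (p div 2) + 2) * real_of_rat q + (4 * (real (p div 2) + 2) + 1) * (real (p div 2) + 4))"
  unfolding radial_tameness_def
proof (intro ballI allI impI)
  fix P s t and q :: rat
  assume "P \<in> X1" and st: "0 \<le> s \<and> s < t \<and> t \<le> 1"
    and gt: "4 * (real (p div 2) + 2) * real_of_rat q + (4 * (real (p div 2) + 2) + 1) * (real (p div 2) + 4)
      < lev (combing P s)"
  from X1_path[OF \<open>P \<in> X1\<close>] obtain x y b where x: "x \<in> p_fractions" and P: "\<And>t. combing P t = path x y b t" by metis
  define h where "h = real (p div 2)"
  define r where "r = real_of_rat q"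
  define l where "l = lev (combing P t)"
  have "l > r"
  proof (rule ccontr)
    assume "\<not> r < l"
    then have lr: "l \<le> r" by simp
    have l0: "0 \<le> l" using lev_path(2)[OF x, of s t y b] st P by (simp add: l_def)
    have h0: "0 \<le> h" by (simp add: h_def)
    have ph: "real p \<le> 2 * h + 1" unfolding h_def by linarith
    have "lev (combing P s) \<le> (h + 4) * (l + real p + 3) + 2 * h + real p + 9"
      using lev_path(1)[OF x, of s t y b] st P by (simp add: l_def h_def)
    also have "\<dots> \<le> (h + 4) * (r + (2 * h + 1) + 3) + 2 * h + (2 * h + 1) + 9"
      using ph lr h0 by (intro add_mono mult_left_mono) auto
    also have "\<dots> = (h + 4) * r + (2 * h * h + 16 * h + 26)" by (simp add: algebra_simps)
    \<comment> \<open>Replacing the slope h + 4 by the larger 4 (h + 2) needs r \<ge> 0, which holds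
      because 0 \<le> l \<le> r. The constants are compared as 2 h^2 + 16 h + 26 against 4 h^2 + 25
      h + 36.\<close>
    also have "\<dots> \<le> 4 * (h + 2) * r + (4 * (h + 2) + 1) * (h + 4)"
    proof (intro add_mono mult_right_mono)
      have "0 \<le> h * h" using h0 by simp
      then have "2 * h * h + 16 * h + 26 \<le> 4 * (h * h) + 25 * h + 36" using h0 by simp
      then show "2 * h * h + 16 * h + 26 \<le> (4 * (h + 2) + 1) * (h + 4)" by (simp add: algebra_simps)
    qed (use h0 lr l0 in auto)
    also have "\<dots> < lev (combing P s)" using gt by (simp add: h_def r_def)
    finally show False by simp
  qed
  then show "real_of_rat q < lev (combing P t)" by (simp add: l_def r_def)
qed

end

theorem theorem6p1:
  fixes p :: nat
  assumes "p \<ge> 3"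
  shows "in_TC bs_inv (bs_rels p)
           (\<lambda>q. 4 * (real (p div 2) + 2) * real_of_rat q
                + (4 * (real (p div 2) + 2) + 1) * (real (p div 2) + 4))"
proof -
  interpret baumslag_solitar p by unfold_locales (rule assms)
  show ?thesis
    unfolding in_TC_def using is_1combing_combing radial_tameness_combing by blast
qed

end
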